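(* Let $\mathcal{A}:\mathbb{S}^n\to\mathbb{R}^m$ be a surjective linear map and $b\in\mathbb{R}^m$, and suppose that the spectrahedron $\mathcal{F}=\{X\in\mathbb{S}^n_+ : \mathcal{A}(X)=b\}$ is non-empty, bounded and contained in a proper face of $\mathbb{S}^n_+$. For $\alpha>0$ let $(X(\alpha),y(\alpha),Z(\alpha))$ be the point of the parametric path at $\alpha$. Then there exists $(\bar X,\bar y,\bar Z)\in \mathbb{S}^n_+\times\mathbb{R}^m\times\mathbb{S}^n_+$ with $\bar X\in\operatorname{relint}(\mathcal{F})$ and $\bar Z=\mathcal{A}^*(\bar y)$ such that $$\lim_{\alpha\searrow 0}(X(\alpha),y(\alpha),Z(\alpha))=(\bar X,\bar y,\bar Z).$$
   Context: $\mathbb{S}^n$ is the space of real symmetric $n\times n$ matrices with inner product $\langle X,Y\rangle=\operatorname{trace}(XY)$; $\mathbb{S}^n_+$ is the cone of positive semidefinite matrices, and $X\succ0$ means $X$ is positive definite. $\mathcal{A}^*:\mathbb{R}^m\to\mathbb{S}^n$ is the adjoint of $\mathcal{A}$, and $\operatorname{relint}$ denotes relative interior. A closed convex cone $f\subseteq\mathbb{S}^n_+$ is a face of $\mathbb{S}^n_+$ if $X,Y\in\mathbb{S}^n_+$ and $X+Y\in f$ imply $X,Y\in f$; it is proper if $f\neq\mathbb{S}^n_+$ and $f\ne 0$. (In particular, $\mathcal{F}$ contains no positive definite matrix.) For $\alpha>0$ set $b(\alpha):=b+\alpha\mathcal{A}(I)$. The parametric path point $(X(\alpha),y(\alpha),Z(\alpha))$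 is the unique solution $(X,y,Z)\in\mathbb{S}^n\times\mathbb{R}^m\times\mathbb{S}^n$ of the system $$\mathcal{A}^*(y)-Z=0,\qquad \mathcal{A}(X)-b(\alpha)=0,\qquad ZX-\alpha I=0,\qquad X\succ0,\ Z\succ0.$$ Equivalently, $X(\alpha)$ is the unique maximizer of $\log\det(X)$ over $\{X\in\mathbb{S}^n_+:\mathcal{A}(X)=b(\alpha)\}$ and $Z(\alpha)=\alpha X(\alpha)^{-1}=\mathcal{A}^*(y(\alpha))$. *)

theory Defs
  imports "HOL-Analysis.Analysis"
begin

definition sym_mats :: "(real^'n^'n) set" where
  "sym_mats = {X. transpose X = X}"

definition psd_mats :: "(real^'n^'n) set" where
  "psd_mats = {X \<in> sym_mats. \<forall>v. 0 \<le> v \<bullet> (X *v v)}"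

definition pos_def_mat :: "real^'n^'n \<Rightarrow> bool" where
  "pos_def_mat X \<longleftrightarrow> X \<in> sym_mats \<and> (\<forall>v. v \<noteq> 0 \<longrightarrow> 0 < v \<bullet> (X *v v))"

(* The operator lives on the subspace of symmetric matrices, so nothing is required of
   its values at non-symmetric matrices, and none of the definitions below depends on them. *)

definition linear_on_sym :: "(real^'n^'n \<Rightarrow> real^'m) \<Rightarrow> bool" where
  "linear_on_sym A \<longleftrightarrow>
     (\<forall>X\<in>sym_mats. \<forall>Y\<in>sym_mats. A (X + Y) = A X + A Y) \<and>
     (\<forall>X\<in>sym_mats. \<forall>c. A (c *\<^sub>R X) = c *\<^sub>R A X)"

(* The library's adjoint would be taken in the space of all square matrices; here the adjoint
   is taken with respect to the trace inner product on the symmetric ones. *)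
definition sym_adjoint :: "(real^'n^'n \<Rightarrow> real^'m) \<Rightarrow> real^'m \<Rightarrow> real^'n^'n" where
  "sym_adjoint A y = (THE Z. Z \<in> sym_mats \<and> (\<forall>X\<in>sym_mats. trace (X ** Z) = A X \<bullet> y))"

definition spectrahedron :: "(real^'n^'n \<Rightarrow> real^'m) \<Rightarrow> real^'m \<Rightarrow> (real^'n^'n) set" where
  "spectrahedron A b = {X \<in> psd_mats. A X = b}"

(* convex_cone includes nonemptiness. *)
definition psd_face :: "(real^'n^'n) set \<Rightarrow> bool" where
  "psd_face f \<longleftrightarrow> closed f \<and> convex_cone f \<and> f \<subseteq> psd_mats \<and>
     (\<forall>X\<in>psd_mats. \<forall>Y\<in>psd_mats. X + Y \<in> f \<longrightarrow> X \<in> f \<and> Y \<in> f)"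

definition proper_psd_face :: "(real^'n^'n) set \<Rightarrow> bool" where
  "proper_psd_face f \<longleftrightarrow> psd_face f \<and> f \<noteq> psd_mats \<and> f \<noteq> {0}"

definition perturbed_rhs :: "(real^'n^'n \<Rightarrow> real^'m) \<Rightarrow> real^'m \<Rightarrow> real \<Rightarrow> real^'m" where
  "perturbed_rhs A b \<alpha> = b + \<alpha> *\<^sub>R A (mat 1)"

fun path_system ::
  "(real^'n^'n \<Rightarrow> real^'m) \<Rightarrow> real^'m \<Rightarrow> real \<Rightarrow> (real^'n^'n) \<times> (real^'m) \<times> (real^'n^'n) \<Rightarrow> bool" where
  "path_system A b \<alpha> (X, y, Z) \<longleftrightarrow>
     sym_adjoint A y - Z = 0 \<and>
     A X - perturbed_rhs A b \<alpha> = 0 \<and>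
     Z ** X - \<alpha> *\<^sub>R mat 1 = 0 \<and>
     pos_def_mat X \<and> pos_def_mat Z"

(* Meaningful only where the system has exactly one solution. *)
definition path_point ::
  "(real^'n^'n \<Rightarrow> real^'m) \<Rightarrow> real^'m \<Rightarrow> real \<Rightarrow> (real^'n^'n) \<times> (real^'m) \<times> (real^'n^'n)" where
  "path_point A b \<alpha> = (THE p. path_system A b \<alpha> p)"

end

theory Submission
  imports Defs
begin

text \<open>
Write \<open>X = X\<^sub>0 + \<alpha> I + \<Sum> t\<^sub>B B\<close> with \<open>X\<^sub>0\<close> in the spectrahedron and \<open>B\<close> running through an
orthonormal basis of the kernel of \<open>A\<close>. Then \<open>X(\<alpha>)\<close> is the unique maximiser of \<open>det\<close> on its slice.
Orthogonality of \<open>Z(\<alpha>)\<close> to the kernel gives \<open>trace Z(\<alpha>) \<le> n\<close>, so the path is bounded near \<open>0\<close>,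
and \<open>W \<le> n X(\<alpha>)\<close> in the Loewner order for every \<open>W\<close> in the spectrahedron, so every limit point
lies in the relative interior.

Convergence is an algebraicity statement. Penalising \<open>det\<close> by \<open>\<epsilon> \<Sum> t\<^sub>B ^ (E + 1) / (E + 1)\<close> with
\<open>E > deg det\<close> turns the critical point equations into \<open>t\<^sub>B ^ E = q\<^sub>B / \<epsilon>\<close> with \<open>deg q\<^sub>B < E\<close>. Modulo
these, polynomials of degree at most \<open>D\<close> reduce to a space whose dimension grows only linearly in
\<open>D\<close>, so by counting every rational function of \<open>(\<alpha>, t)\<close> satisfies a bivariate polynomial relation
with \<open>\<alpha>\<close> whose degree does not depend on \<open>\<epsilon>\<close>. Normalising the coefficients and letting
\<open>\<epsilon> \<rightarrow> 0\<close> yields such a relation for each entry of \<open>X(\<alpha>)\<close> and, by Cramer's rule, of \<open>Z(\<alpha>)\<close>; and a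
bounded continuous algebraic function on \<open>(0, 1]\<close> has a limit at \<open>0\<close>.
\<close>

section \<open>Algebraic relations from bounded-degree elimination\<close>

text \<open>Elimination removes one equation and one unknown at a time. Arbitrary finite index sets
  are allowed because later the unknowns are pairs of exponents and the equations are reduced
  monomials.\<close>

lemma homogeneous_system_nontrivial:
  fixes M :: "'i \<Rightarrow> 'j \<Rightarrow> real"
  assumes "finite J" "finite I" "card J < card I"
  shows "\<exists>c. (\<exists>i\<in>I. c i \<noteq> 0) \<and> (\<forall>j\<in>J. (\<Sum>i\<in>I. c i * M i j) = 0)"
  using assms
proof (induction J arbitrary: I M rule: finite_induct)
  case empty
  then obtain i where "i \<in> I" by (metis card.empty card_gt_0_iff ex_in_conv)
  then show ?case by (intro exI[of _ "\<lambda>_. 1"]) auto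
next
  case (insert j J)
  show ?case
  proof (cases "\<forall>i\<in>I. M i j = 0")
    case True
    have "card J < card I" using insert by simp
    from insert.IH[OF insert.prems(1) this, of M] obtain c where
      "\<exists>i\<in>I. c i \<noteq> 0" "\<forall>j\<in>J. (\<Sum>i\<in>I. c i * M i j) = 0" by blast
    then show ?thesis using True by (intro exI[of _ c]) auto
  next
    case False
    then obtain p where p: "p \<in> I" "M p j \<noteq> 0" by blast
    \<comment> \<open>\<open>N\<close> is \<open>M\<close> after equation \<open>j\<close> has been
      solved for the unknown \<open>p\<close>; a solution of the smaller system extends by the value
      that \<open>d\<close> takes at \<open>p\<close>.\<close>
    define N where "N i k = M i k - M i j / M p j * M p k" for i k
    have "card J < card (I - {p})" using insert p by auto
    from insert.IH[OF _ this, of N] insert.prems obtain c where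
      c: "\<exists>i\<in>I-{p}. c i \<noteq> 0" "\<forall>k\<in>J. (\<Sum>i\<in>I-{p}. c i * N i k) = 0" by auto
    define d where "d = c(p := - (\<Sum>i\<in>I-{p}. c i * M i j) / M p j)"
    have split: "(\<Sum>i\<in>I. d i * M i k) = d p * M p k + (\<Sum>i\<in>I-{p}. c i * M i k)" for k
      using p insert.prems by (simp add: sum.remove[of I p] d_def)
    have eq: "(\<Sum>i\<in>I. d i * M i k) = (\<Sum>i\<in>I-{p}. c i * N i k)" for k
      unfolding split N_def
      by (simp add: d_def right_diff_distrib sum_subtractf sum_distrib_right sum_divide_distrib mult.assoc)
    have "(\<Sum>i\<in>I. d i * M i j) = 0"
      unfolding split using p by (simp add: d_def)
    moreover have "\<exists>i\<in>I. d i \<noteq> 0" using c(1) by (auto simp: d_def)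
    ultimately show ?thesis using c(2) eq by (intro exI[of _ d]) auto
  qed
qed

text \<open>Bolzano-Weierstrass one index at a time. It extracts a limit of the normalised
  coefficients of the algebraic relations.\<close>

lemma bounded_family_convergent_subseq:
  fixes c :: "nat \<Rightarrow> 'i \<Rightarrow> real"
  assumes "finite I" "\<And>k i. i \<in> I \<Longrightarrow> \<bar>c k i\<bar> \<le> B"
  shows "\<exists>r. strict_mono r \<and> (\<forall>i\<in>I. \<exists>l. (\<lambda>k. c (r k) i) \<longlonglongrightarrow> l)"
  using assms
proof (induction I rule: finite_induct)
  case empty
  show ?case by (intro exI[of _ id]) (auto simp: strict_mono_def)
next
  case (insert i I)
  then obtain r where r: "strict_mono r" "\<forall>i\<in>I. \<exists>l. (\<lambda>k. c (r k) i) \<longlonglongrightarrow> l" by auto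
  have "c (r k) i \<in> {-B..B}" for k
    using insert.prems[of i "r k"] by (simp add: abs_le_iff)
  then have "\<forall>k. c (r k) i \<in> {-B..B}" by blast
  from seq_compactE[OF compact_imp_seq_compact[OF compact_Icc] this] obtain l s where
    s: "strict_mono (s::nat\<Rightarrow>nat)" "((\<lambda>k. c (r k) i) \<circ> s) \<longlonglongrightarrow> l" by blast
  have "\<exists>l. (\<lambda>k. c ((r \<circ> s) k) j) \<longlonglongrightarrow> l" if "j \<in> insert i I" for j
  proof (cases "j = i")
    case True
    then show ?thesis using s by (intro exI[of _ l]) (simp add: o_def)
  next
    case False
    then have "j \<in> I" using that by simp
    from bspec[OF r(2) this] obtain l' where "(\<lambda>k. c (r k) j) \<longlonglongrightarrow> l'" by (elim exE)
    from LIMSEQ_subseq_LIMSEQ[OF this s(1)] show ?thesis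
      by (intro exI[of _ l']) (simp add: o_def)
  qed
  then show ?case using strict_mono_o[OF r(1) s(1)] by (intro exI[of _ "r \<circ> s"] conjI ballI)
qed

section \<open>Polynomial functions of bounded degree and their reduction\<close>

text \<open>Polynomials are handled as functions of the valuation \<open>x\<close>, and
  \<open>d\<close> bounds the degree of one presentation from above. Rule induction reduces claims
  to monomials and sums.\<close>

inductive poly_deg :: "'v set \<Rightarrow> nat \<Rightarrow> (('v \<Rightarrow> real) \<Rightarrow> real) \<Rightarrow> bool" for U where
  mono: "sum \<beta> U \<le> d \<Longrightarrow> poly_deg U d (\<lambda>x. c * (\<Prod>v\<in>U. x v ^ \<beta> v))"
| add: "poly_deg U d f \<Longrightarrow> poly_deg U d g \<Longrightarrow> poly_deg U d (\<lambda>x. f x + g x)"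

lemma poly_deg_const [intro]: "poly_deg U d (\<lambda>_. c)"
  using poly_deg.mono[of "\<lambda>_. 0" U d c] by simp

lemma poly_deg_var:
  assumes "finite U" "v \<in> U" "1 \<le> d"
  shows "poly_deg U d (\<lambda>x. x v)"
proof -
  have "(\<Prod>u\<in>U. x u ^ (if u = v then 1 else 0)) = x v" for x :: "'a \<Rightarrow> real"
    using assms by (simp add: if_distrib[of "\<lambda>k. _ ^ k"] cong: if_cong)
  then show ?thesis
    using poly_deg.mono[of "\<lambda>u. if u = v then 1 else 0" U d 1] assms by simp
qed

lemma poly_deg_mult:
  assumes "poly_deg U d f" "poly_deg U e g"
  shows "poly_deg U (d + e) (\<lambda>x. f x * g x)"
  using assms(1)
proof (induction rule: poly_deg.induct)
  case (mono \<beta> d c)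
  show ?case using assms(2)
  proof (induction rule: poly_deg.induct)
    case (mono \<gamma> e c')
    have "poly_deg U (d + e) (\<lambda>x. (c * c') * (\<Prod>v\<in>U. x v ^ (\<beta> v + \<gamma> v)))"
      using mono \<open>sum \<beta> U \<le> d\<close> by (intro poly_deg.mono) (simp add: sum.distrib)
    then show ?case by (simp add: power_add prod.distrib mult_ac)
  next
    case (add e f g)
    then show ?case by (simp add: distrib_left poly_deg.add)
  qed
next
  case (add d f1 f2)
  then show ?case by (simp add: distrib_right poly_deg.add)
qed

lemma poly_deg_sum:
  "(\<And>i. i \<in> I \<Longrightarrow> poly_deg U d (f i)) \<Longrightarrow> poly_deg U d (\<lambda>x. \<Sum>i\<in>I. f i x)"
  by (induction I rule: infinite_finite_induct) (auto intro: poly_deg.add)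

lemma poly_deg_prod:
  "finite I \<Longrightarrow> (\<And>i. i \<in> I \<Longrightarrow> poly_deg U d (f i)) \<Longrightarrow> poly_deg U (card I * d) (\<lambda>x. \<Prod>i\<in>I. f i x)"
  by (induction I rule: finite_induct) (auto intro: poly_deg_mult)

lemma poly_deg_power: "poly_deg U d f \<Longrightarrow> poly_deg U (k * d) (\<lambda>x. f x ^ k)"
  by (induction k) (auto intro: poly_deg_mult)

text \<open>The bound \<open>d\<close> is kept instead of being lowered by one: the later
  elimination only asks for a degree below \<open>E\<close>.\<close>

lemma poly_deg_partial:
  assumes "poly_deg U d f" "finite U" "v \<in> U"
  shows "\<exists>g. poly_deg U d g \<and>
           (\<forall>x. ((\<lambda>s. f (x(v := s))) has_real_derivative g x) (at (x v)))"
  using assms(1)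
proof (induction rule: poly_deg.induct)
  case (mono \<beta> d c)
  \<comment> \<open>If \<open>\<beta> v = 0\<close>, the truncated subtraction is harmless, since
    the factor \<open>real (\<beta> v)\<close> is zero.\<close>
  let ?\<gamma> = "\<beta>(v := \<beta> v - 1)"
  have "sum ?\<gamma> U \<le> sum \<beta> U" by (intro sum_mono) auto
  then have "poly_deg U d (\<lambda>x. (c * real (\<beta> v)) * (\<Prod>u\<in>U. x u ^ ?\<gamma> u))"
    using mono by (intro poly_deg.mono) simp
  moreover have "((\<lambda>s. c * (\<Prod>u\<in>U. (x(v := s)) u ^ \<beta> u)) has_real_derivative
      (c * real (\<beta> v)) * (\<Prod>u\<in>U. x u ^ ?\<gamma> u)) (at (x v))" for x
  proof -
    have "(\<Prod>u\<in>U. (x(v := s)) u ^ \<beta> u) = s ^ \<beta> v * (\<Prod>u\<in>U-{v}. x u ^ \<beta> u)" for s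
      using assms by (simp add: prod.remove[of U v])
    moreover have "(\<Prod>u\<in>U. x u ^ ?\<gamma> u) = x v ^ (\<beta> v - 1) * (\<Prod>u\<in>U-{v}. x u ^ \<beta> u)"
      using assms by (simp add: prod.remove[of U v])
    ultimately show ?thesis
      by (auto intro!: derivative_eq_intros)
  qed
  ultimately show ?case by blast
next
  case (add d f1 f2)
  from add.IH(1) obtain g1 where g1: "poly_deg U d g1"
    "\<And>x. ((\<lambda>s. f1 (x(v := s))) has_real_derivative g1 x) (at (x v))" by (auto simp del: fun_upd_apply)
  from add.IH(2) obtain g2 where g2: "poly_deg U d g2"
    "\<And>x. ((\<lambda>s. f2 (x(v := s))) has_real_derivative g2 x) (at (x v))" by (auto simp del: fun_upd_apply)
  show ?case
    by (intro exI[of _ "\<lambda>x. g1 x + g2 x"] conjI allI DERIV_add poly_deg.add g1 g2)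
qed

text \<open>Exponents of the monomials that survive division by the relations \<open>x\<^sub>v ^ E = q\<^sub>v\<close>.\<close>

definition reduced_exps :: "'v set \<Rightarrow> 'v \<Rightarrow> nat \<Rightarrow> nat \<Rightarrow> ('v \<Rightarrow> nat) set" where
  "reduced_exps V a E d = PiE (insert a V) (\<lambda>v. if v = a then {..d} else {..<E})"

text \<open>The exponent of \<open>a\<close> ranges up to \<open>d\<close> and every other exponent
  has \<open>E\<close> choices, so the count is linear in \<open>d\<close>. The counting in
  \<open>algebraic_relation\<close> rests on this growth rate.\<close>

lemma card_reduced_exps:
  assumes "finite V" "a \<notin> V"
  shows "finite (reduced_exps V a E d)" "card (reduced_exps V a E d) = (d + 1) * E ^ card V"
proof -
  show "finite (reduced_exps V a E d)"
    unfolding reduced_exps_def using assms by (intro finite_PiE) auto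
  have "(\<Prod>v\<in>V. card (if v = a then {..d} else {..<E})) = (\<Prod>v\<in>V. E)"
    using assms by (intro prod.cong) auto
  then show "card (reduced_exps V a E d) = (d + 1) * E ^ card V"
    unfolding reduced_exps_def using assms by (subst card_PiE) auto
qed

text \<open>On \<open>S\<close> a factor \<open>x v ^ E\<close> can be traded for
  \<open>q v x\<close>, which lowers the degree because \<open>e < E\<close>; hence strong induction
  on \<open>d\<close>. \<open>D\<close> stays fixed, so all remainders are indexed by the same
  finite set.\<close>

lemma poly_deg_reduce:
  fixes S :: "('v \<Rightarrow> real) set"
  assumes V: "finite V" "a \<notin> V"
    and q: "\<And>v. v \<in> V \<Longrightarrow> poly_deg (insert a V) e (q v)" and "e < E"
    and S: "\<And>x v. x \<in> S \<Longrightarrow> v \<in> V \<Longrightarrow> x v ^ E = q v x"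
    and f: "poly_deg (insert a V) d f" and D: "d \<le> D"
  shows "\<exists>c. \<forall>x\<in>S. f x = (\<Sum>\<beta>\<in>reduced_exps V a E D. c \<beta> * (\<Prod>v\<in>insert a V. x v ^ \<beta> v))"
  using f D
proof (induction d arbitrary: f rule: less_induct)
  case (less d)
  let ?U = "insert a V" and ?R = "reduced_exps V a E D"
  let ?P = "\<lambda>f. \<exists>c. \<forall>x\<in>S. f x = (\<Sum>\<beta>\<in>?R. c \<beta> * (\<Prod>v\<in>?U. x v ^ \<beta> v))"
  note IH = less.IH and D = \<open>d \<le> D\<close>
  \<comment> \<open>The degree is an index of \<open>poly_deg\<close>, so the inner rule induction
    carries a variable \<open>d'\<close> tied to \<open>d\<close> by an equation.\<close>
  have "d' = d \<Longrightarrow> ?P f" if "poly_deg ?U d' f" for d' and f :: "('v \<Rightarrow> real) \<Rightarrow> real"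
    using that
  proof (induction rule: poly_deg.induct)
    case (mono \<beta> d' c)
    show ?case
    proof (cases "\<exists>v\<in>V. E \<le> \<beta> v")
      case False
      have "\<beta> a \<le> D" using mono V D by simp
      \<comment> \<open>Members of \<open>PiE\<close> are undefined outside the index set, hence the
        restriction.\<close>
      define \<gamma> where "\<gamma> = restrict \<beta> ?U"
      have "\<gamma> \<in> ?R" using False \<open>\<beta> a \<le> D\<close> by (auto simp: reduced_exps_def \<gamma>_def not_le)
      moreover have "(\<Prod>v\<in>?U. x v ^ \<beta> v) = (\<Prod>v\<in>?U. x v ^ \<gamma> v)" for x :: "'v \<Rightarrow> real"
        by (intro prod.cong) (auto simp: \<gamma>_def)
      ultimately show ?thesis using card_reduced_exps(1)[OF V]
        by (intro exI[of _ "\<lambda>\<beta>'. if \<beta>' = \<gamma> then c else 0"])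
          (simp add: if_distrib[of "\<lambda>k. k * _"] cong: if_cong)
    next
      case True
      then obtain w where w: "w \<in> V" "E \<le> \<beta> w" by blast
      \<comment> \<open>\<open>\<gamma>\<close> takes \<open>E\<close> from the exponent of
        \<open>w\<close>, while \<open>q w\<close> gives back degree at most
        \<open>e\<close>.\<close>
      define \<gamma> where "\<gamma> = \<beta>(w := \<beta> w - E)"
      define g where "g = (\<lambda>x. (c * (\<Prod>v\<in>?U. x v ^ \<gamma> v)) * q w x)"
      have "w \<in> ?U" "finite ?U" using w V by auto
      then have "sum \<beta> ?U = \<beta> w + sum \<beta> (?U - {w})" "sum \<gamma> ?U = \<gamma> w + sum \<gamma> (?U - {w})"
        by (meson sum.remove)+
      moreover have "sum \<gamma> (?U - {w}) = sum \<beta> (?U - {w})" by (simp add: \<gamma>_def)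
      ultimately have "sum \<gamma> ?U + E = sum \<beta> ?U" using w by (simp add: \<gamma>_def)
      then have small: "sum \<gamma> ?U + e < d" using mono \<open>e < E\<close> by simp
      have "poly_deg ?U (sum \<gamma> ?U + e) g"
        unfolding g_def using q[OF w(1)] by (intro poly_deg_mult poly_deg.mono) auto
      from IH[OF small this] obtain c' where
        "\<forall>x\<in>S. g x = (\<Sum>\<beta>\<in>?R. c' \<beta> * (\<Prod>v\<in>?U. x v ^ \<beta> v))"
        using small D by auto
      moreover have "c * (\<Prod>v\<in>?U. x v ^ \<beta> v) = g x" if "x \<in> S" for x
      proof -
        have "(\<Prod>v\<in>?U. x v ^ \<beta> v) = x w ^ \<beta> w * (\<Prod>v\<in>?U-{w}. x v ^ \<beta> v)"
          using \<open>w \<in> ?U\<close> \<open>finite ?U\<close> by (meson prod.remove)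
        also have "x w ^ \<beta> w = x w ^ \<gamma> w * q w x"
          using S[OF that w(1)] w(2) power_add[of "x w" "\<beta> w - E" E] by (simp add: \<gamma>_def)
        also have "(\<Prod>v\<in>?U-{w}. x v ^ \<beta> v) = (\<Prod>v\<in>?U-{w}. x v ^ \<gamma> v)"
          by (intro prod.cong) (auto simp: \<gamma>_def)
        also have "x w ^ \<gamma> w * q w x * \<dots> = (\<Prod>v\<in>?U. x v ^ \<gamma> v) * q w x"
          using \<open>w \<in> ?U\<close> \<open>finite ?U\<close> by (simp add: prod.remove[of ?U w])
        finally show ?thesis by (simp add: g_def)
      qed
      ultimately show ?thesis by auto
    qed
  next
    case (add d f g)
    then obtain c c' where
      "\<forall>x\<in>S. f x = (\<Sum>\<beta>\<in>?R. c \<beta> * (\<Prod>v\<in>?U. x v ^ \<beta> v))"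
      "\<forall>x\<in>S. g x = (\<Sum>\<beta>\<in>?R. c' \<beta> * (\<Prod>v\<in>?U. x v ^ \<beta> v))" by blast
    then show ?case
      by (intro exI[of _ "\<lambda>\<beta>. c \<beta> + c' \<beta>"]) (simp add: distrib_right sum.distrib)
  qed
  then show ?case using less.prems by blast
qed

text \<open>The products indexed by \<open>(i, j)\<close> have degree at most
  \<open>2 * K * r\<close>, so on \<open>S\<close> they lie in the span of
  \<open>(2 * K * r + 1) * E ^ card V\<close> reduced monomials. For this \<open>K\<close> the pairs
  outnumber the monomials, which forces a linear relation. It is homogeneous in \<open>h\<close> and
  \<open>g\<close>, hence a division-free relation for \<open>h / g\<close>, and its degrees depend
  on \<open>E\<close>, \<open>card V\<close> and \<open>r\<close> but not on the coefficients of
  \<open>q\<close>.\<close>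

lemma algebraic_relation:
  fixes S :: "('v \<Rightarrow> real) set"
  assumes V: "finite V" "a \<notin> V"
    and q: "\<And>v. v \<in> V \<Longrightarrow> poly_deg (insert a V) e (q v)" and "e < E"
    and S: "\<And>x v. x \<in> S \<Longrightarrow> v \<in> V \<Longrightarrow> x v ^ E = q v x"
    and h: "poly_deg (insert a V) r h" and g: "poly_deg (insert a V) r g"
    and K: "K = 2 * E ^ card V"
  shows "\<exists>c. (\<forall>i\<in>{..K * r}\<times>{..K}. \<bar>c i\<bar> \<le> 1) \<and> (\<exists>i\<in>{..K * r}\<times>{..K}. \<bar>c i\<bar> = 1) \<and>
    (\<forall>x\<in>S. (\<Sum>(i, j)\<in>{..K * r}\<times>{..K}. c (i, j) * (x a ^ i * (h x ^ j * g x ^ (K - j)))) = 0)"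
proof -
  let ?U = "insert a V" and ?I = "{..K * r}\<times>{..K}"
  define D where "D = K * r + K * r"
  let ?R = "reduced_exps V a E D"
  define f where "f = (\<lambda>(i, j) x. x a ^ i * (h x ^ j * g x ^ (K - j)))"
  have "\<exists>c. \<forall>x\<in>S. f p x = (\<Sum>\<beta>\<in>?R. c \<beta> * (\<Prod>v\<in>?U. x v ^ \<beta> v))" if "p \<in> ?I" for p
  proof -
    obtain i j where p1: "p = (i, j)" by (cases p)
    then have p: "p = (i, j)" "i \<le> K * r" "j \<le> K" using that by simp_all
    have "poly_deg ?U (i * 1 + (j * r + (K - j) * r)) (\<lambda>x. x a ^ i * (h x ^ j * g x ^ (K - j)))"
      using V h g by (intro poly_deg_mult poly_deg_power poly_deg_var) auto
    moreover have "j * r + (K - j) * r = K * r" using p(3) by (simp flip: distrib_right)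
    ultimately have "poly_deg ?U (i + K * r) (f p)" by (simp add: f_def p)
    then show ?thesis
      using p(2) by (intro poly_deg_reduce[OF V q \<open>e < E\<close> S]) (auto simp: D_def)
  qed
  then obtain M where M: "\<And>p x. p \<in> ?I \<Longrightarrow> x \<in> S \<Longrightarrow> f p x = (\<Sum>\<beta>\<in>?R. M p \<beta> * (\<Prod>v\<in>?U. x v ^ \<beta> v))"
    by metis
  have "1 \<le> E ^ card V" using \<open>e < E\<close> by simp
  then have "(2 * (K * r) + 1) * E ^ card V < (K * r + 1) * (K + 1)"
  proof -
    have "(2 * (K * r) + 1) * E ^ card V \<le> (2 * (K * r) + 2) * E ^ card V" by simp
    also have "\<dots> = (K * r + 1) * K" by (simp add: K)
    also have "\<dots> < (K * r + 1) * (K + 1)" by simp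
    finally show ?thesis .
  qed
  then have "card ?R < card ?I"
    using card_reduced_exps(2)[OF V, of E D] by (simp add: card_cartesian_product D_def mult_2)
  from homogeneous_system_nontrivial[OF card_reduced_exps(1)[OF V] _ this, of M] obtain c where
    c: "\<exists>i\<in>?I. c i \<noteq> 0" "\<forall>\<beta>\<in>?R. (\<Sum>i\<in>?I. c i * M i \<beta>) = 0" by auto
  \<comment> \<open>Dividing by the largest modulus keeps the relation from degenerating in a
    limit.\<close>
  define m where "m = Max ((\<lambda>i. \<bar>c i\<bar>) ` ?I)"
  have le: "\<bar>c i\<bar> \<le> m" if "i \<in> ?I" for i unfolding m_def using that by (intro Max_ge) auto
  then have "m > 0" using c(1) by force
  have "m \<in> (\<lambda>i. \<bar>c i\<bar>) ` ?I" unfolding m_def by (intro Max_in) auto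
  then obtain i0 where i0: "i0 \<in> ?I" "\<bar>c i0\<bar> = m" by auto
  have zero: "(\<Sum>i\<in>?I. c i * f i x) = 0" if "x \<in> S" for x
  proof -
    have "(\<Sum>i\<in>?I. c i * f i x) = (\<Sum>i\<in>?I. \<Sum>\<beta>\<in>?R. c i * M i \<beta> * (\<Prod>v\<in>?U. x v ^ \<beta> v))"
      using M[OF _ that] by (intro sum.cong) (auto simp: sum_distrib_left mult.assoc)
    also have "\<dots> = (\<Sum>\<beta>\<in>?R. (\<Sum>i\<in>?I. c i * M i \<beta>) * (\<Prod>v\<in>?U. x v ^ \<beta> v))"
      by (subst sum.swap) (simp only: sum_distrib_right)
    also have "\<dots> = 0" using c(2) by simp
    finally show ?thesis .
  qed
  have "(\<Sum>(i, j)\<in>?I. c (i, j) / m * (x a ^ i * (h x ^ j * g x ^ (K - j)))) = 0" if "x \<in> S" for x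
  proof -
    have "(\<Sum>(i, j)\<in>?I. c (i, j) / m * (x a ^ i * (h x ^ j * g x ^ (K - j)))) = (\<Sum>i\<in>?I. c i * f i x) / m"
      unfolding sum_divide_distrib by (intro sum.cong) (auto simp: f_def)
    then show ?thesis using zero[OF that] by simp
  qed
  moreover have "\<forall>i\<in>?I. \<bar>c i / m\<bar> \<le> 1" using le \<open>m > 0\<close> by (simp add: abs_divide)
  moreover have "\<exists>i\<in>?I. \<bar>c i / m\<bar> = 1" using i0 \<open>m > 0\<close> by (intro bexI[of _ i0]) (simp_all add: abs_divide)
  ultimately show ?thesis by (intro exI[of _ "\<lambda>i. c i / m"] conjI) blast+
qed

section \<open>Limits of algebraic functions at zero\<close>

text \<open>Cancelling the lowest power of \<alpha> in the relation leaves
  \<open>p (z \<alpha>) = O(\<alpha>)\<close> with a nonzero polynomial \<open>p\<close>. So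
  \<open>z\<close> approaches the finite root set of \<open>p\<close>, and continuity forbids moving
  from one root to another.\<close>

lemma algebraic_limit_exists:
  fixes z :: "real \<Rightarrow> real"
  assumes cont: "continuous_on {0<..1} z"
    and bnd: "\<And>\<alpha>. 0 < \<alpha> \<Longrightarrow> \<alpha> \<le> 1 \<Longrightarrow> \<bar>z \<alpha>\<bar> \<le> B"
    and nz: "\<exists>i\<le>M. \<exists>j\<le>K. c (i, j) \<noteq> (0::real)"
    and rel: "\<And>\<alpha>. 0 < \<alpha> \<Longrightarrow> \<alpha> \<le> 1 \<Longrightarrow> (\<Sum>(i, j)\<in>{..M}\<times>{..K}. c (i, j) * (\<alpha> ^ i * z \<alpha> ^ j)) = 0"
  shows "\<exists>l. (z \<longlongrightarrow> l) (at_right 0)"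
proof -
  define i0 where "i0 = (LEAST i. \<exists>j\<le>K. c (i, j) \<noteq> 0)"
  obtain i1 j1 where ij: "i1 \<le> M" "j1 \<le> K" "c (i1, j1) \<noteq> 0" using nz by blast
  have i0: "\<exists>j\<le>K. c (i0, j) \<noteq> 0" unfolding i0_def by (rule LeastI) (use ij in blast)
  have "i0 \<le> M" unfolding i0_def using ij by (intro order_trans[OF Least_le[of _ i1]]) blast+
  have below: "c (i, j) = 0" if "i < i0" "j \<le> K" for i j
    using not_less_Least[of i "\<lambda>i. \<exists>j\<le>K. c (i, j) \<noteq> 0"] that by (auto simp: i0_def)
  define p where "p w = (\<Sum>j\<le>K. c (i0, j) * w ^ j)" for w
  have fin: "finite {w. p w = 0}"
    unfolding p_def using i0 polyfun_finite_roots[of "\<lambda>j. c (i0, j)" K] by auto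
  define C where "C = (\<Sum>i=Suc i0..M. \<Sum>j\<le>K. \<bar>c (i, j)\<bar> * \<bar>B\<bar> ^ j)"
  have small: "\<bar>p (z \<alpha>)\<bar> \<le> \<alpha> * C" if \<alpha>: "0 < \<alpha>" "\<alpha> \<le> 1" for \<alpha>
  proof -
    define T where "T i = (\<Sum>j\<le>K. c (i, j) * z \<alpha> ^ j)" for i
    have "0 = (\<Sum>i\<le>M. \<alpha> ^ i * T i)"
      using rel[OF \<alpha>] unfolding T_def
      by (simp add: sum.cartesian_product[symmetric] sum_distrib_left mult_ac)
    also have "\<dots> = (\<Sum>i=i0..M. \<alpha> ^ i * T i)"
      by (rule sum.mono_neutral_right) (auto simp: T_def below)
    also have "\<dots> = \<alpha> ^ i0 * T i0 + (\<Sum>i=Suc i0..M. \<alpha> ^ i * T i)"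
      using \<open>i0 \<le> M\<close> by (simp add: sum.atLeast_Suc_atMost)
    also have "(\<Sum>i=Suc i0..M. \<alpha> ^ i * T i) = \<alpha> ^ i0 * (\<alpha> * (\<Sum>i=Suc i0..M. \<alpha> ^ (i - Suc i0) * T i))"
    proof -
      have "\<alpha> ^ i * T i = \<alpha> ^ i0 * (\<alpha> * (\<alpha> ^ (i - Suc i0) * T i))" if "Suc i0 \<le> i" for i
      proof -
        have "i = i0 + 1 + (i - Suc i0)" using that by simp
        then have "\<alpha> ^ i = \<alpha> ^ i0 * \<alpha> * \<alpha> ^ (i - Suc i0)" by (metis power_add power_one_right)
        then show ?thesis by simp
      qed
      then show ?thesis unfolding sum_distrib_left by (intro sum.cong) auto
    qed
    finally have "p (z \<alpha>) = - (\<alpha> * (\<Sum>i=Suc i0..M. \<alpha> ^ (i - Suc i0) * T i))"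
      using \<alpha> by (simp add: p_def T_def[symmetric] flip: distrib_left)
    then have "\<bar>p (z \<alpha>)\<bar> = \<alpha> * \<bar>\<Sum>i=Suc i0..M. \<alpha> ^ (i - Suc i0) * T i\<bar>"
      using \<alpha> by (simp add: abs_mult)
    moreover have "\<bar>\<Sum>i=Suc i0..M. \<alpha> ^ (i - Suc i0) * T i\<bar> \<le> C"
      unfolding C_def
    proof (rule order_trans[OF sum_abs], rule sum_mono)
      fix i
      have "\<bar>T i\<bar> \<le> (\<Sum>j\<le>K. \<bar>c (i, j)\<bar> * \<bar>B\<bar> ^ j)"
        unfolding T_def using bnd[OF \<alpha>]
        by (intro order_trans[OF sum_abs] sum_mono) (auto simp: abs_mult power_abs intro!: mult_left_mono power_mono)
      moreover have "\<bar>\<alpha> ^ (i - Suc i0)\<bar> \<le> 1" using \<alpha> by (simp add: power_le_one)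
      ultimately show "\<bar>\<alpha> ^ (i - Suc i0) * T i\<bar> \<le> (\<Sum>j\<le>K. \<bar>c (i, j)\<bar> * \<bar>B\<bar> ^ j)"
        unfolding abs_mult using mult_left_le_one_le[of "\<bar>T i\<bar>" "\<bar>\<alpha> ^ (i - Suc i0)\<bar>"] by linarith
    qed
    ultimately show ?thesis using \<alpha> by simp
  qed
  \<comment> \<open>Compactness along the samples \<open>1 / Suc k\<close> provides the candidate
    \<open>l\<close> for the limit.\<close>
  have "z (1 / real (Suc k)) \<in> {-B..B}" for k
    using bnd[of "1 / real (Suc k)"] by (auto simp: abs_le_iff)
  then have "\<forall>k. z (1 / real (Suc k)) \<in> {-B..B}" by blast
  then obtain l s where
    s: "strict_mono (s::nat\<Rightarrow>nat)" "((\<lambda>k. z (1 / real (Suc k))) \<circ> s) \<longlonglongrightarrow> l"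
    by (rule seq_compactE[OF compact_imp_seq_compact[OF compact_Icc],
        where f = "\<lambda>k. z (1 / real (Suc k))"])
  have "(z \<longlongrightarrow> l) (at_right 0)"
  proof (rule tendstoI, rule ccontr)
    fix e :: real assume "e > 0" and "\<not> (\<forall>\<^sub>F \<alpha> in at_right 0. dist (z \<alpha>) l < e)"
    then have "\<forall>b>0. \<exists>\<alpha>. 0 < \<alpha> \<and> \<alpha> < b \<and> e \<le> \<bar>z \<alpha> - l\<bar>"
      unfolding eventually_at_right_field dist_real_def by (meson not_less)
    then have far: "\<exists>\<alpha>. 0 < \<alpha> \<and> \<alpha> < b \<and> e \<le> \<bar>z \<alpha> - l\<bar>" if "b > 0" for b
      using that by blast
    \<comment> \<open>The roots occupy finitely many distances from \<open>l\<close>, so some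
      positive \<open>d\<close> below \<open>e\<close> has neither \<open>l + d\<close> nor
      \<open>l - d\<close> as a root.\<close>
    have "finite ((\<lambda>w. \<bar>w - l\<bar>) ` {w. p w = 0})" using fin by simp
    moreover have "infinite {0<..<e}" using \<open>e > 0\<close> by (simp add: infinite_Ioo)
    ultimately have "\<not> {0<..<e} \<subseteq> (\<lambda>w. \<bar>w - l\<bar>) ` {w. p w = 0}" using finite_subset by blast
    then obtain d where d: "d \<in> {0<..<e}" "d \<notin> (\<lambda>w. \<bar>w - l\<bar>) ` {w. p w = 0}" by blast
    define m where "m = min \<bar>p (l + d)\<bar> \<bar>p (l - d)\<bar>"
    have "p (l + d) \<noteq> 0" "p (l - d) \<noteq> 0" using d by force+
    then have "m > 0" by (simp add: m_def)
    \<comment> \<open>For parameters below \<open>b\<close>, the bound \<open>\<alpha> * C\<close>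
      on the modulus of \<open>p (z \<alpha>)\<close> is smaller than \<open>m\<close>.\<close>
    define b where "b = min 1 (m / (\<bar>C\<bar> + 1))"
    have "b > 0" using \<open>m > 0\<close> by (simp add: b_def)
    obtain \<alpha> where \<alpha>: "0 < \<alpha>" "\<alpha> < b" "e \<le> \<bar>z \<alpha> - l\<bar>" using far[OF \<open>b > 0\<close>] by blast
    have "\<forall>\<^sub>F k in sequentially. \<bar>z (1 / real (Suc (s k))) - l\<bar> < d"
      using tendstoD[OF s(2), of d] d by (simp add: dist_real_def)
    moreover have "\<forall>\<^sub>F k in sequentially. 1 / real (Suc (s k)) < b"
      using LIMSEQ_subseq_LIMSEQ[OF LIMSEQ_inverse_real_of_nat s(1)] \<open>b > 0\<close>
      by (intro order_tendstoD(2)[of _ 0]) (auto simp: o_def inverse_eq_divide)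
    ultimately have "\<forall>\<^sub>F k in sequentially. \<bar>z (1 / real (Suc (s k))) - l\<bar> < d \<and> 1 / real (Suc (s k)) < b"
      by (rule eventually_conj)
    then obtain k where k: "\<bar>z (1 / real (Suc (s k))) - l\<bar> < d" "1 / real (Suc (s k)) < b"
      by (auto simp: eventually_sequentially)
    define \<beta> where "\<beta> = 1 / real (Suc (s k))"
    have \<beta>: "0 < \<beta>" "\<beta> < b" "\<bar>z \<beta> - l\<bar> < d" using k by (auto simp: \<beta>_def)
    \<comment> \<open>The distance of \<open>z\<close> to \<open>l\<close> is below \<open>d\<close>
      at \<open>\<beta>\<close> and at least \<open>e\<close>, hence above \<open>d\<close>, at
      \<open>\<alpha>\<close>. It therefore equals \<open>d\<close> somewhere in
      \<open>{0<..<b}\<close>, where \<open>p (z \<gamma>)\<close> has modulus at least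
      \<open>m\<close>.\<close>
    have "connected ((\<lambda>\<alpha>. \<bar>z \<alpha> - l\<bar>) ` {0<..<b})"
      by (intro connected_continuous_image continuous_intros continuous_on_subset[OF cont])
        (auto simp: b_def)
    moreover have "\<bar>z \<alpha> - l\<bar> \<in> (\<lambda>\<alpha>. \<bar>z \<alpha> - l\<bar>) ` {0<..<b}" "\<bar>z \<beta> - l\<bar> \<in> (\<lambda>\<alpha>. \<bar>z \<alpha> - l\<bar>) ` {0<..<b}"
      using \<alpha> \<beta> by auto
    ultimately have "d \<in> (\<lambda>\<alpha>. \<bar>z \<alpha> - l\<bar>) ` {0<..<b}"
      using \<alpha>(3) \<beta>(3) d(1) by (intro connectedD_interval[of _ "\<bar>z \<beta> - l\<bar>" "\<bar>z \<alpha> - l\<bar>" d]) simp_all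
    then obtain \<gamma> where \<gamma>: "0 < \<gamma>" "\<gamma> < b" "\<bar>z \<gamma> - l\<bar> = d" by auto
    then have "z \<gamma> = l + d \<or> z \<gamma> = l - d" by linarith
    then have "m \<le> \<bar>p (z \<gamma>)\<bar>" by (auto simp: m_def)
    also have "\<dots> \<le> \<gamma> * C" using \<gamma> by (intro small) (auto simp: b_def)
    also have "\<dots> \<le> \<gamma> * (\<bar>C\<bar> + 1)" using \<gamma> by (intro mult_left_mono) auto
    also have "\<gamma> * (\<bar>C\<bar> + 1) < m"
    proof -
      have "\<gamma> < m / (\<bar>C\<bar> + 1)" using \<gamma>(2) by (simp add: b_def)
      then show ?thesis by (subst (asm) pos_less_divide_eq) auto
    qed
    finally show False by simp
  qed
  then show ?thesis by blast
qed

text \<open>For each \<open>k\<close> the points \<open>x k \<alpha>\<close> solve equations whose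
  right-hand sides are scaled by \<open>Suc k\<close>. The degrees of the resulting relation are
  independent of \<open>k\<close>, so its normalised coefficients converge along a subsequence, and
  \<open>z\<close>, the limit of \<open>h / g\<close>, satisfies the limit relation.\<close>

lemma algebraic_curve_limit:
  fixes x :: "nat \<Rightarrow> real \<Rightarrow> 'v \<Rightarrow> real" and z G :: "real \<Rightarrow> real"
  assumes V: "finite V" "a \<notin> V"
    and q: "\<And>v. v \<in> V \<Longrightarrow> poly_deg (insert a V) e (q v)" and "e < E"
    and h: "poly_deg (insert a V) r h" and g: "poly_deg (insert a V) r g"
    and sol: "\<And>\<alpha>. 0 < \<alpha> \<Longrightarrow> \<alpha> \<le> 1 \<Longrightarrow> \<forall>\<^sub>F k in sequentially.
      x k \<alpha> a = \<alpha> \<and> (\<forall>v\<in>V. x k \<alpha> v ^ E = real (Suc k) * q v (x k \<alpha>))"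
    and limh: "\<And>\<alpha>. 0 < \<alpha> \<Longrightarrow> \<alpha> \<le> 1 \<Longrightarrow> (\<lambda>k. h (x k \<alpha>)) \<longlonglongrightarrow> z \<alpha> * G \<alpha>"
    and limg: "\<And>\<alpha>. 0 < \<alpha> \<Longrightarrow> \<alpha> \<le> 1 \<Longrightarrow> (\<lambda>k. g (x k \<alpha>)) \<longlonglongrightarrow> G \<alpha>"
    and G: "\<And>\<alpha>. 0 < \<alpha> \<Longrightarrow> \<alpha> \<le> 1 \<Longrightarrow> G \<alpha> \<noteq> 0"
    and cont: "continuous_on {0<..1} z"
    and bnd: "\<And>\<alpha>. 0 < \<alpha> \<Longrightarrow> \<alpha> \<le> 1 \<Longrightarrow> \<bar>z \<alpha>\<bar> \<le> B"
  shows "\<exists>l. (z \<longlongrightarrow> l) (at_right 0)"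
proof -
  define K where "K = 2 * E ^ card V"
  define S where "S k = {x. \<forall>v\<in>V. x v ^ E = real (Suc k) * q v x}" for k
  let ?I = "{..K * r} \<times> {..K}"
  let ?T = "\<lambda>c \<alpha> u w. \<Sum>(i, j)\<in>?I. c (i, j) * (\<alpha> ^ i * (u ^ j * w ^ (K - j))) :: real"
  have "\<exists>c. (\<forall>i\<in>?I. \<bar>c i\<bar> \<le> 1) \<and> (\<exists>i\<in>?I. \<bar>c i\<bar> = 1) \<and> (\<forall>x\<in>S k. ?T c (x a) (h x) (g x) = 0)" for k
  proof (rule algebraic_relation[OF V _ \<open>e < E\<close> _ h g K_def])
    show "poly_deg (insert a V) e (\<lambda>x. real (Suc k) * q v x)" if "v \<in> V" for v
      using poly_deg_mult[OF poly_deg_const[of _ 0 "real (Suc k)"] q[OF that]] by simp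
    show "x v ^ E = real (Suc k) * q v x" if "x \<in> S k" "v \<in> V" for x v
      using that by (simp add: S_def)
  qed
  then have "\<forall>k. \<exists>c. (\<forall>i\<in>?I. \<bar>c i\<bar> \<le> 1) \<and> (\<exists>i\<in>?I. \<bar>c i\<bar> = 1) \<and> (\<forall>x\<in>S k. ?T c (x a) (h x) (g x) = 0)"
    by (rule allI)
  from choice[OF this] obtain c where
    c: "\<forall>k. (\<forall>i\<in>?I. \<bar>c k i\<bar> \<le> 1) \<and> (\<exists>i\<in>?I. \<bar>c k i\<bar> = 1) \<and> (\<forall>x\<in>S k. ?T (c k) (x a) (h x) (g x) = 0)"
    by (elim exE)
  note c' = spec[OF c]
  have c1: "\<bar>c k i\<bar> \<le> 1" if "i \<in> ?I" for k i
    using bspec[OF conjunct1[OF c'] that] .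
  have c2: "\<exists>i\<in>?I. \<bar>c k i\<bar> = 1" for k
    using conjunct1[OF conjunct2[OF c']] .
  have c3: "?T (c k) (y a) (h y) (g y) = 0" if "y \<in> S k" for k y
    using bspec[OF conjunct2[OF conjunct2[OF c']] that] .
  \<comment> \<open>The coefficients \<open>c k\<close> do not depend on \<alpha>, so one
    subsequence serves all parameter values.\<close>
  obtain s where s: "strict_mono s" "\<forall>i\<in>?I. \<exists>l. (\<lambda>k. c (s k) i) \<longlonglongrightarrow> l"
    using bounded_family_convergent_subseq[of ?I c 1] c1 by auto
  from bchoice[OF s(2)] obtain L where L': "\<forall>i\<in>?I. (\<lambda>k. c (s k) i) \<longlonglongrightarrow> L i"
    by (elim exE)
  note L = bspec[OF L']
  \<comment> \<open>The index of modulus \<open>1\<close> may change with \<open>k\<close>; the sum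
    of the moduli keeps its lower bound in the limit, so \<open>L\<close> is not zero.\<close>
  have "1 \<le> (\<Sum>i\<in>?I. \<bar>c k i\<bar>)" for k
  proof -
    obtain i where "i \<in> ?I" "\<bar>c k i\<bar> = 1" using c2 by meson
    then show ?thesis using member_le_sum[of i ?I "\<lambda>i. \<bar>c k i\<bar>"] by simp
  qed
  moreover have "(\<lambda>k. \<Sum>i\<in>?I. \<bar>c (s k) i\<bar>) \<longlonglongrightarrow> (\<Sum>i\<in>?I. \<bar>L i\<bar>)"
    by (intro tendsto_intros L)
  ultimately have "1 \<le> (\<Sum>i\<in>?I. \<bar>L i\<bar>)"
    by (intro LIMSEQ_le_const) auto
  then have "\<not> (\<forall>i\<in>?I. \<bar>L i\<bar> = 0)" using sum.neutral[of ?I "\<lambda>i. \<bar>L i\<bar>"] by linarith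
  then have nz: "\<exists>i\<le>K * r. \<exists>j\<le>K. L (i, j) \<noteq> 0" by auto
  have rel: "(\<Sum>(i, j)\<in>?I. L (i, j) * (\<alpha> ^ i * z \<alpha> ^ j)) = 0" if \<alpha>: "0 < \<alpha>" "\<alpha> \<le> 1" for \<alpha>
  proof -
    have "(\<lambda>k. ?T (c (s k)) \<alpha> (h (x (s k) \<alpha>)) (g (x (s k) \<alpha>))) \<longlonglongrightarrow> ?T L \<alpha> (z \<alpha> * G \<alpha>) (G \<alpha>)"
      unfolding case_prod_beta
      by (intro tendsto_intros L
          LIMSEQ_subseq_LIMSEQ[OF limh[OF \<alpha>] s(1), unfolded o_def]
          LIMSEQ_subseq_LIMSEQ[OF limg[OF \<alpha>] s(1), unfolded o_def]) simp
    moreover have "\<forall>\<^sub>F k in sequentially. ?T (c (s k)) \<alpha> (h (x (s k) \<alpha>)) (g (x (s k) \<alpha>)) = 0"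
    proof (rule eventually_mono[OF eventually_subseq[OF s(1) sol[OF \<alpha>]]])
      fix k assume *: "x (s k) \<alpha> a = \<alpha> \<and> (\<forall>v\<in>V. x (s k) \<alpha> v ^ E = real (Suc (s k)) * q v (x (s k) \<alpha>))"
      then have "x (s k) \<alpha> \<in> S (s k)" by (simp add: S_def)
      then show "?T (c (s k)) \<alpha> (h (x (s k) \<alpha>)) (g (x (s k) \<alpha>)) = 0" using c3[of "x (s k) \<alpha>" "s k"] * by simp
    qed
    ultimately have "?T L \<alpha> (z \<alpha> * G \<alpha>) (G \<alpha>) = 0"
      by (rule LIMSEQ_unique[OF _ tendsto_eventually])
    \<comment> \<open>Dehomogenising: the factor \<open>G \<alpha> ^ K\<close> splits off and is
      nonzero.\<close>
    also have "?T L \<alpha> (z \<alpha> * G \<alpha>) (G \<alpha>) = G \<alpha> ^ K * (\<Sum>(i, j)\<in>?I. L (i, j) * (\<alpha> ^ i * z \<alpha> ^ j))"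
      unfolding sum_distrib_left
    proof (rule sum.cong, rule refl, unfold split_paired_all case_prod_conv)
      fix i j assume "(i, j) \<in> ?I"
      then have "j \<le> K" by simp
      then have "G \<alpha> ^ K = G \<alpha> ^ j * G \<alpha> ^ (K - j)" by (simp flip: power_add)
      then show "L (i, j) * (\<alpha> ^ i * ((z \<alpha> * G \<alpha>) ^ j * G \<alpha> ^ (K - j))) =
          G \<alpha> ^ K * (L (i, j) * (\<alpha> ^ i * z \<alpha> ^ j))"
        by (simp only: power_mult_distrib mult_ac)
    qed
    finally show ?thesis using G[OF \<alpha>] by simp
  qed
  show ?thesis by (rule algebraic_limit_exists[OF cont bnd nz rel])
qed

section \<open>Positive semidefinite matrices\<close>

lemma sym_matD: "X \<in> sym_mats \<Longrightarrow> X $ i $ j = X $ j $ i"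
  by (metis (mono_tags, lifting) mem_Collect_eq sym_mats_def transpose_def vec_lambda_beta)

lemma sym_matI: "(\<And>i j. X $ i $ j = X $ j $ i) \<Longrightarrow> X \<in> sym_mats"
  by (simp add: sym_mats_def transpose_def vec_eq_iff)

lemma subspace_sym_mats: "subspace sym_mats"
  unfolding subspace_def by (auto intro!: sym_matI simp: sym_matD)

lemma sym_mat_1: "mat 1 \<in> sym_mats"
  by (simp add: sym_mats_def)

lemma sym_inner_mult:
  assumes "X \<in> sym_mats"
  shows "u \<bullet> (X *v w) = w \<bullet> (X *v u)"
proof -
  have "u \<bullet> (X *v w) = (transpose X *v u) \<bullet> w" by (simp add: dot_lmul_matrix)
  also have "transpose X = X" using assms by (simp add: sym_mats_def)
  finally show ?thesis by (simp add: inner_commute)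
qed

lemma psd_sym: "X \<in> psd_mats \<Longrightarrow> X \<in> sym_mats"
  and psd_nonneg: "X \<in> psd_mats \<Longrightarrow> 0 \<le> v \<bullet> (X *v v)"
  by (auto simp: psd_mats_def)

lemma pd_sym: "pos_def_mat X \<Longrightarrow> X \<in> sym_mats"
  and pd_pos: "pos_def_mat X \<Longrightarrow> v \<noteq> 0 \<Longrightarrow> 0 < v \<bullet> (X *v v)"
  by (auto simp: pos_def_mat_def)

lemma pd_imp_psd: "pos_def_mat X \<Longrightarrow> X \<in> psd_mats"
  unfolding pos_def_mat_def psd_mats_def
  by (auto, metis inner_zero_left less_eq_real_def)

lemma pd_mat_1: "pos_def_mat (mat 1)"
  by (simp add: pos_def_mat_def sym_mat_1)

lemma pd_add_psd: "pos_def_mat X \<Longrightarrow> Y \<in> psd_mats \<Longrightarrow> pos_def_mat (X + Y)"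
  using subspace_sym_mats
  by (auto simp: pos_def_mat_def psd_mats_def matrix_vector_mult_add_rdistrib inner_add_right
      subspace_def add_pos_nonneg)

lemma pd_scale: "pos_def_mat X \<Longrightarrow> 0 < c \<Longrightarrow> pos_def_mat (c *\<^sub>R X)"
  using subspace_sym_mats
  by (auto simp: pos_def_mat_def subspace_def scaleR_matrix_vector_assoc[symmetric])

lemma psd_add: "X \<in> psd_mats \<Longrightarrow> Y \<in> psd_mats \<Longrightarrow> X + Y \<in> psd_mats"
  using subspace_sym_mats
  by (auto simp: psd_mats_def matrix_vector_mult_add_rdistrib inner_add_right subspace_def)

lemma psd_scale: "X \<in> psd_mats \<Longrightarrow> 0 \<le> c \<Longrightarrow> c *\<^sub>R X \<in> psd_mats"
  using subspace_sym_mats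
  by (auto simp: psd_mats_def subspace_def scaleR_matrix_vector_assoc[symmetric])

lemma convex_psd: "convex psd_mats"
  by (auto simp: convex_def intro!: psd_add psd_scale)

lemma continuous_quadratic_form: "continuous_on UNIV (\<lambda>X::real^'n^'n. v \<bullet> (X *v v))"
proof -
  have "linear (\<lambda>X::real^'n^'n. v \<bullet> (X *v v))"
    by (rule linearI)
      (simp_all add: matrix_vector_mult_add_rdistrib inner_add_right scaleR_matrix_vector_assoc[symmetric])
  then show ?thesis by (rule linear_continuous_on[OF linear_conv_bounded_linear[THEN iffD1]])
qed

lemma closed_psd: "closed (psd_mats :: (real^'n^'n) set)"
proof -
  have "closed {X :: real^'n^'n. 0 \<le> v \<bullet> (X *v v)}" for v
    by (intro closed_Collect_le continuous_quadratic_form continuous_on_const)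
  then have "closed (sym_mats \<inter> (\<Inter>v. {X :: real^'n^'n. 0 \<le> v \<bullet> (X *v v)}))"
    using closed_subspace[OF subspace_sym_mats] by (intro closed_Int closed_INT) auto
  moreover have "psd_mats = sym_mats \<inter> (\<Inter>v. {X :: real^'n^'n. 0 \<le> v \<bullet> (X *v v)})"
    by (auto simp: psd_mats_def)
  ultimately show ?thesis by simp
qed

lemma psd_Cauchy_Schwarz:
  assumes X: "X \<in> psd_mats"
  shows "(u \<bullet> (X *v w))\<^sup>2 \<le> (u \<bullet> (X *v u)) * (w \<bullet> (X *v w))"
proof -
  define a b c where "a = u \<bullet> (X *v u)" and "b = u \<bullet> (X *v w)" and "c = w \<bullet> (X *v w)"
  have quad: "0 \<le> a + 2 * s * b + s\<^sup>2 * c" for s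
  proof -
    have "0 \<le> (u + s *\<^sub>R w) \<bullet> (X *v (u + s *\<^sub>R w))" by (rule psd_nonneg[OF X])
    also have "\<dots> = a + 2 * s * b + s\<^sup>2 * c"
      using sym_inner_mult[OF psd_sym[OF X], of w u]
      by (simp add: a_def b_def c_def matrix_vector_right_distrib matrix_vector_mult_scaleR inner_add_left
          inner_add_right power2_eq_square algebra_simps)
    finally show ?thesis .
  qed
  have c: "0 \<le> c" unfolding c_def by (rule psd_nonneg[OF X])
  have "b\<^sup>2 \<le> a * c"
  proof (cases "c = 0")
    case True
    have "b = 0"
    proof (rule ccontr)
      assume "b \<noteq> 0"
      \<comment> \<open>This value of \<open>s\<close> makes \<open>a + 2 * s * b\<close> equal to
        \<open>-1\<close>.\<close>
      then show False using quad[of "- (a + 1) / (2 * b)"] True by (simp add: field_simps)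
    qed
    then show ?thesis using True by simp
  next
    case False
    then have "0 < c" using c by simp
    \<comment> \<open>\<open>s = - b / c\<close> minimises the quadratic.\<close>
    have "0 \<le> c * (a + 2 * (- b / c) * b + (- b / c)\<^sup>2 * c)"
      using quad[of "- b / c"] \<open>0 < c\<close> by (intro mult_nonneg_nonneg) auto
    also have "\<dots> = a * c - b\<^sup>2" using \<open>0 < c\<close> by (simp add: field_simps power2_eq_square)
    finally show ?thesis by simp
  qed
  then show ?thesis by (simp add: a_def b_def c_def)
qed

lemma psd_zero_form:
  assumes X: "X \<in> psd_mats" and "v \<bullet> (X *v v) = 0"
  shows "X *v v = 0"
proof -
  have "((X *v v) \<bullet> (X *v v))\<^sup>2 \<le> 0"
    using psd_Cauchy_Schwarz[OF X, of "X *v v" v] assms(2) by simp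
  then show ?thesis by simp
qed

section \<open>The trace pairing on the cone\<close>

definition outer :: "real^'n \<Rightarrow> real^'n^'n" where
  "outer v = (\<chi> i j. v $ i * v $ j)"

lemma outer_mult: "outer v *v u = (u \<bullet> v) *\<^sub>R v"
  by (simp add: outer_def vec_eq_iff matrix_vector_mult_def inner_vec_def sum_distrib_left mult_ac)

lemma outer_sym: "outer v \<in> sym_mats"
  by (rule sym_matI) (simp add: outer_def)

lemma inner_outer: "outer v \<bullet> X = v \<bullet> (X *v v)"
  by (simp add: outer_def inner_vec_def matrix_vector_mult_def sum_distrib_left mult_ac)

text \<open>Symmetric elimination in place of a spectral decomposition: a nonzero diagonal entry
  splits off a rank-one term, which pairs nonnegatively with \<open>Z\<close>, and the remaining
  Schur complement has one more row known to vanish. \<open>S\<close> holds the rows still allowed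
  to be nonzero.\<close>

lemma inner_psd_nonneg_supported:
  fixes X Z :: "real^'n^'n"
  assumes Z: "Z \<in> psd_mats" and "finite S" and "X \<in> psd_mats" "\<And>i. i \<notin> S \<Longrightarrow> X $ i = 0"
  shows "0 \<le> X \<bullet> Z"
  using assms(2-)
proof (induction S arbitrary: X rule: finite_induct)
  case empty
  then have "X = 0" by (simp add: vec_eq_iff)
  then show ?case by simp
next
  case (insert i S)
  note sX = sym_matD[OF psd_sym[OF insert.prems(1)]]
  define a where "a = X $ i $ i"
  have col: "X *v axis i 1 = X $ i"
    using sX by (simp add: vec_eq_iff matrix_vector_mult_basis column_def)
  have form: "axis i 1 \<bullet> (X *v axis i 1) = a" by (simp add: col a_def inner_axis')
  have "0 \<le> a" using psd_nonneg[OF insert.prems(1), of "axis i 1"] form by simp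
  show ?case
  proof (cases "a = 0")
    \<comment> \<open>A zero diagonal entry of a positive semidefinite matrix annihilates its row,
      so this row is already eliminated.\<close>
    case True
    then have "X $ i = 0" using psd_zero_form[OF insert.prems(1), of "axis i 1"] form col by simp
    then show ?thesis using insert by (metis insertE)
  next
    case False
    then have "0 < a" using \<open>0 \<le> a\<close> by simp
    define Y where "Y = X - (1 / a) *\<^sub>R outer (X $ i)"
    have "Y \<in> psd_mats"
      unfolding psd_mats_def
    proof (clarsimp, intro conjI allI)
      show "Y \<in> sym_mats" unfolding Y_def
        using subspace_sym_mats psd_sym[OF insert.prems(1)] outer_sym
        by (intro subspace_diff subspace_scale)
      fix v
      have "(v \<bullet> X $ i)\<^sup>2 \<le> (v \<bullet> (X *v v)) * a"
        using psd_Cauchy_Schwarz[OF insert.prems(1), of v "axis i 1"] form col by simp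
      then have "(v \<bullet> X $ i)\<^sup>2 / a \<le> v \<bullet> (X *v v)"
        using \<open>0 < a\<close> by (simp add: pos_divide_le_eq)
      then show "0 \<le> v \<bullet> (Y *v v)"
        by (simp add: Y_def matrix_vector_mult_diff_rdistrib scaleR_matrix_vector_assoc[symmetric]
            outer_mult inner_diff_right power2_eq_square)
    qed
    moreover have "Y $ j = 0" if "j \<notin> S" for j
    proof (cases "j = i")
      case True
      then show ?thesis using \<open>0 < a\<close> by (simp add: Y_def outer_def vec_eq_iff a_def)
    next
      case False
      then have "X $ j = 0" using insert.prems(2) that by simp
      moreover from this have "X $ i $ j = 0" using sX[of i j] by simp
      ultimately show ?thesis by (simp add: Y_def outer_def vec_eq_iff)
    qed
    ultimately have "0 \<le> Y \<bullet> Z" by (rule insert.IH)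
    moreover have "0 \<le> (1 / a) * (outer (X $ i) \<bullet> Z)"
      using \<open>0 < a\<close> psd_nonneg[OF Z] by (simp add: inner_outer)
    moreover have "X \<bullet> Z = Y \<bullet> Z + (1 / a) * (outer (X $ i) \<bullet> Z)"
      by (simp add: Y_def inner_diff_left)
    ultimately show ?thesis by simp
  qed
qed

lemma inner_psd_nonneg: "X \<in> psd_mats \<Longrightarrow> Z \<in> psd_mats \<Longrightarrow> 0 \<le> X \<bullet> Z"
  by (rule inner_psd_nonneg_supported[of Z UNIV]) auto

text \<open>\<open>Z\<close> is \<alpha> times the inverse of \<open>X\<close>, so Cauchy-Schwarz
  for \<open>Z\<close> with the vector \<open>X *v v\<close> shows that \<open>Z\<close> dominates
  the multiple \<open>\<alpha> / c\<close> of \<open>outer v\<close> in the Loewner order. Pairing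
  with \<open>M\<close> gives the bound.\<close>

lemma psd_form_le_inner:
  assumes Z: "pos_def_mat Z" and X: "pos_def_mat X" and ZX: "Z ** X = \<alpha> *\<^sub>R mat 1" and "0 < \<alpha>"
    and M: "M \<in> psd_mats"
  shows "\<alpha> * (v \<bullet> (M *v v)) \<le> (Z \<bullet> M) * (v \<bullet> (X *v v))"
proof (cases "v = 0")
  case False
  define c where "c = v \<bullet> (X *v v)"
  have "0 < c" unfolding c_def by (rule pd_pos[OF X False])
  have ZXv: "Z *v (X *v v) = \<alpha> *\<^sub>R v"
    by (simp add: matrix_vector_mul_assoc ZX flip: scaleR_matrix_vector_assoc)
  define N where "N = Z - (\<alpha> / c) *\<^sub>R outer v"
  have "N \<in> psd_mats"
    unfolding psd_mats_def
  proof (clarsimp, intro conjI allI)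
    show "N \<in> sym_mats" unfolding N_def
      using subspace_sym_mats pd_sym[OF Z] outer_sym by (intro subspace_diff subspace_scale)
    fix u
    have "(\<alpha> * (u \<bullet> v))\<^sup>2 \<le> (u \<bullet> (Z *v u)) * (\<alpha> * c)"
      using psd_Cauchy_Schwarz[OF pd_imp_psd[OF Z], of u "X *v v"] ZXv
      by (simp add: c_def inner_commute)
    then have "\<alpha> * (\<alpha> * (u \<bullet> v)\<^sup>2) \<le> \<alpha> * ((u \<bullet> (Z *v u)) * c)"
      by (simp add: power2_eq_square mult_ac)
    then have "\<alpha> * (u \<bullet> v)\<^sup>2 \<le> (u \<bullet> (Z *v u)) * c" using \<open>0 < \<alpha>\<close> by simp
    then have "\<alpha> * (u \<bullet> v)\<^sup>2 / c \<le> u \<bullet> (Z *v u)"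
      using \<open>0 < c\<close> by (simp add: pos_divide_le_eq)
    then show "0 \<le> u \<bullet> (N *v u)"
      by (simp add: N_def matrix_vector_mult_diff_rdistrib scaleR_matrix_vector_assoc[symmetric]
          outer_mult inner_diff_right power2_eq_square)
  qed
  then have "0 \<le> N \<bullet> M" using M by (rule inner_psd_nonneg)
  also have "N \<bullet> M = Z \<bullet> M - (\<alpha> / c) * (v \<bullet> (M *v v))"
    by (simp add: N_def inner_diff_left inner_outer)
  finally show ?thesis using \<open>0 < c\<close> by (simp add: c_def[symmetric] field_simps)
qed simp

lemma trace_mult_eq_inner: "trace (A ** B) = A \<bullet> transpose (B :: real^'n^'n)"
  by (simp add: trace_def matrix_matrix_mult_def inner_vec_def transpose_def)

lemma trace_mult_sym: "B \<in> sym_mats \<Longrightarrow> trace (A ** B) = A \<bullet> B"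
  by (simp add: trace_mult_eq_inner sym_mats_def)

lemma inverse_pair_commute:
  fixes X Z :: "real^'n^'n"
  assumes "Z ** X = \<alpha> *\<^sub>R mat 1" "\<alpha> \<noteq> 0"
  shows "X ** Z = \<alpha> *\<^sub>R mat 1"
proof -
  have "((1 / \<alpha>) *\<^sub>R Z) ** X = mat 1"
    using assms by (simp flip: scalar_matrix_assoc)
  then have "X ** ((1 / \<alpha>) *\<^sub>R Z) = mat 1" using matrix_left_right_inverse by blast
  then have "(1 / \<alpha>) *\<^sub>R (X ** Z) = mat 1"
    by (simp add: matrix_scalar_ac flip: scalar_matrix_assoc)
  then have "\<alpha> *\<^sub>R ((1 / \<alpha>) *\<^sub>R (X ** Z)) = \<alpha> *\<^sub>R mat 1" by simp
  then show ?thesis using assms(2) by simp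
qed

text \<open>Monotonicity of the inverse: \<open>trace (D Z\<^sub>1 D Z\<^sub>2) = 0\<close> forces \<open>D = X\<^sub>1 - X\<^sub>2\<close> to vanish.\<close>

lemma inverse_pair_unique:
  fixes X1 X2 Z1 Z2 :: "real^'n^'n"
  assumes pd: "pos_def_mat X1" "pos_def_mat Z1" "pos_def_mat X2" "pos_def_mat Z2" and "0 < \<alpha>"
    and inv: "Z1 ** X1 = \<alpha> *\<^sub>R mat 1" "Z2 ** X2 = \<alpha> *\<^sub>R mat 1"
    and orth: "(Z1 - Z2) \<bullet> (X1 - X2) = 0"
  shows "X1 = X2"
proof -
  define D where "D = X1 - X2"
  have D: "D \<in> sym_mats" unfolding D_def
    using subspace_sym_mats pd pd_sym by (intro subspace_diff) auto
  define M where "M = D ** Z2 ** D"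
  have Mv: "v \<bullet> (M *v v) = (D *v v) \<bullet> (Z2 *v (D *v v))" for v
    using sym_inner_mult[OF D, of v "Z2 *v (D *v v)"]
    by (simp add: M_def inner_commute flip: matrix_vector_mul_assoc)
  have M: "M \<in> psd_mats"
    unfolding psd_mats_def using Mv psd_nonneg[OF pd_imp_psd[OF pd(4)]] D pd_sym[OF pd(4)]
    by (simp add: sym_mats_def M_def matrix_transpose_mul matrix_mul_assoc)
  have "X2 ** Z2 = \<alpha> *\<^sub>R mat 1" using inverse_pair_commute[OF inv(2)] \<open>0 < \<alpha>\<close> by simp
  then have XZ2: "X2 *v (Z2 *v v) = \<alpha> *\<^sub>R v" for v
    by (simp add: matrix_vector_mul_assoc flip: scaleR_matrix_vector_assoc)
  have ZX1: "Z1 *v (X1 *v v) = \<alpha> *\<^sub>R v" for v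
    by (simp add: matrix_vector_mul_assoc inv(1) flip: scaleR_matrix_vector_assoc)
  \<comment> \<open>The resolvent identity for the two scaled inverses.\<close>
  have "(Z1 ** D ** Z2) *v v = (\<alpha> *\<^sub>R Z2 - \<alpha> *\<^sub>R Z1) *v v" for v
    by (simp add: D_def XZ2 ZX1 matrix_vector_mult_diff_rdistrib matrix_vector_mult_diff_distrib
        matrix_vector_mult_scaleR scaleR_matrix_vector_assoc[symmetric] flip: matrix_vector_mul_assoc)
  then have "Z1 ** D ** Z2 = \<alpha> *\<^sub>R Z2 - \<alpha> *\<^sub>R Z1"
    using matrix_eq by blast
  then have "Z1 ** M = (\<alpha> *\<^sub>R (Z2 - Z1)) ** D"
    by (simp add: M_def matrix_mul_assoc scaleR_diff_right)
  then have "trace (Z1 ** M) = \<alpha> * ((Z2 - Z1) \<bullet> D)"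
    using trace_mult_sym[OF D, of "\<alpha> *\<^sub>R (Z2 - Z1)"] by simp
  then have "Z1 \<bullet> M = 0"
    using orth trace_mult_sym[OF psd_sym[OF M], of Z1]
    by (simp add: D_def inner_diff_left)
  \<comment> \<open>The vanishing pairing with \<open>Z1\<close> kills the form of \<open>M\<close>,
    which is the form of \<open>Z2\<close> at \<open>D *v v\<close>.\<close>
  then have "v \<bullet> (M *v v) \<le> 0" for v
    using psd_form_le_inner[OF pd(2,1) inv(1) \<open>0 < \<alpha>\<close> M, of v] \<open>0 < \<alpha>\<close>
    by (simp add: mult_le_0_iff)
  then have "D *v v = 0" for v
    using pd_pos[OF pd(4), of "D *v v"] Mv[of v] by (metis not_le)
  then have "D = 0" by (simp add: matrix_eq)
  then show ?thesis by (simp add: D_def)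
qed

text \<open>The norm of \<open>L X\<close> has a positive minimum on the compact set of unit-norm
  elements of the cone, and homogeneity does the rest. With \<open>symA\<close> this bounds the
  slices, with \<open>trace\<close> it bounds \<open>Zp\<close>.\<close>

lemma linear_psd_norm_bound:
  fixes L :: "real^'n^'n \<Rightarrow> 'a::euclidean_space"
  assumes L: "linear L" and ker: "\<And>X. X \<in> psd_mats \<Longrightarrow> L X = 0 \<Longrightarrow> X = 0"
  shows "\<exists>C\<ge>0. \<forall>X\<in>psd_mats. norm X \<le> C * norm (L X)"
proof -
  let ?K = "psd_mats \<inter> sphere 0 1 :: (real^'n^'n) set"
  have K: "compact ?K" by (rule closed_Int_compact[OF closed_psd compact_sphere])
  have scaled: "(1 / norm X) *\<^sub>R X \<in> ?K" if "X \<in> psd_mats" "X \<noteq> 0" for X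
    using that by (auto intro: psd_scale)
  show ?thesis
  proof (cases "?K = {}")
    case True
    then have "X = 0" if "X \<in> psd_mats" for X :: "real^'n^'n" using scaled[of X] that by blast
    then show ?thesis by (intro exI[of _ 0]) auto
  next
    case False
    have "continuous_on ?K (\<lambda>X. norm (L X))"
      using L by (intro continuous_on_norm linear_continuous_on) (simp add: linear_conv_bounded_linear)
    from continuous_attains_inf[OF K False this] obtain W where
      W: "W \<in> ?K" "\<And>Y. Y \<in> ?K \<Longrightarrow> norm (L W) \<le> norm (L Y)" by blast
    define c where "c = norm (L W)"
    have "W \<noteq> 0" using W(1) by auto
    then have "c > 0" using ker[of W] W(1) by (auto simp: c_def)
    have "norm X \<le> (1 / c) * norm (L X)" if "X \<in> psd_mats" for X
    proof (cases "X = 0")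
      case False
      have "c \<le> norm (L ((1 / norm X) *\<^sub>R X))" unfolding c_def by (intro W scaled that False)
      also have "\<dots> = norm (L X) / norm X" by (simp add: linear_cmul[OF L])
      finally show ?thesis using False \<open>c > 0\<close> by (simp add: field_simps)
    qed (use \<open>c > 0\<close> in simp)
    then show ?thesis using \<open>c > 0\<close> by (intro exI[of _ "1 / c"]) auto
  qed
qed

section \<open>Determinants and their derivatives\<close>

lemma continuous_on_det: "continuous_on S (det :: real^'n^'n \<Rightarrow> real)"
  unfolding det_def by (intro continuous_intros)

lemma pd_det_nz: "pos_def_mat X \<Longrightarrow> det X \<noteq> 0"
proof
  assume X: "pos_def_mat X" and "det X = 0"
  then obtain v where "v \<noteq> 0" "X *v v = 0"
    by (metis invertible_det_nz invertible_left_inverse matrix_left_invertible_ker)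
  then show False using pd_pos[OF X, of v] by simp
qed

text \<open>The segment from the identity to \<open>X\<close> consists of positive definite
  matrices, so the determinant has no zero along it.\<close>

lemma pd_det_pos:
  assumes X: "pos_def_mat X"
  shows "0 < det X"
proof (rule ccontr)
  assume "\<not> 0 < det X"
  define W where "W s = (1 - s) *\<^sub>R mat 1 + s *\<^sub>R X" for s :: real
  have "continuous_on {0..1} (\<lambda>s. det (W s))"
    unfolding W_def by (intro continuous_on_compose2[OF continuous_on_det[of UNIV]] continuous_intros) auto
  then have "\<exists>s\<ge>0. s \<le> 1 \<and> det (W s) = 0"
    using \<open>\<not> 0 < det X\<close> by (intro IVT2') (auto simp: W_def)
  then obtain s where s: "0 \<le> s" "s \<le> 1" "det (W s) = 0" by blast
  have "pos_def_mat (W s)"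
  proof (cases "s = 1")
    case False
    then show ?thesis unfolding W_def using s X
      by (intro pd_add_psd pd_scale pd_mat_1 psd_scale pd_imp_psd) auto
  qed (use X in \<open>simp add: W_def\<close>)
  then show False using pd_det_nz s(3) by blast
qed

lemma psd_det_nz_imp_pd:
  fixes X :: "real^'n^'n"
  assumes X: "X \<in> psd_mats" and "det X \<noteq> 0"
  shows "pos_def_mat X"
  unfolding pos_def_mat_def
proof (intro conjI allI impI)
  show "X \<in> sym_mats" using X by (rule psd_sym)
  fix v :: "real^'n" assume "v \<noteq> 0"
  have "X *v v \<noteq> 0"
    using assms(2) \<open>v \<noteq> 0\<close> by (metis invertible_det_nz invertible_left_inverse matrix_left_invertible_ker)
  then show "0 < v \<bullet> (X *v v)"
    using psd_nonneg[OF X, of v] psd_zero_form[OF X, of v] by linarith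
qed

text \<open>On the unit sphere the minimum of the form of \<open>X\<close> absorbs small multiples
  of the form of \<open>B\<close>. At a positive definite maximiser this permits two-sided
  derivative tests along kernel directions.\<close>

lemma pd_perturb:
  fixes X B :: "real^'n^'n"
  assumes X: "pos_def_mat X" and B: "B \<in> sym_mats"
  shows "\<exists>d>0. \<forall>s. \<bar>s\<bar> < d \<longrightarrow> X + s *\<^sub>R B \<in> psd_mats"
proof -
  let ?K = "sphere 0 1 :: (real^'n) set"
  have ne: "?K \<noteq> {}" by simp
  have cX: "continuous_on ?K (\<lambda>v. v \<bullet> (X *v v))" and cB: "continuous_on ?K (\<lambda>v. \<bar>v \<bullet> (B *v v)\<bar>)"
    by (intro continuous_intros linear_continuous_on matrix_vector_mul_bounded_linear)+
  from continuous_attains_inf[OF compact_sphere ne cX] obtain w where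
    w: "w \<in> ?K" "\<And>v. v \<in> ?K \<Longrightarrow> w \<bullet> (X *v w) \<le> v \<bullet> (X *v v)" by blast
  from continuous_attains_sup[OF compact_sphere ne cB] obtain u where
    u: "u \<in> ?K" "\<And>v. v \<in> ?K \<Longrightarrow> \<bar>v \<bullet> (B *v v)\<bar> \<le> \<bar>u \<bullet> (B *v u)\<bar>" by blast
  define m where "m = w \<bullet> (X *v w)"
  define M where "M = \<bar>u \<bullet> (B *v u)\<bar>"
  have "m > 0" unfolding m_def using w(1) by (intro pd_pos[OF X]) auto
  have "M \<ge> 0" by (simp add: M_def)
  \<comment> \<open>The \<open>+ 1\<close> covers a form of \<open>B\<close> that is identically
    zero.\<close>
  define d where "d = m / (M + 1)"
  have "d > 0" using \<open>m > 0\<close> \<open>M \<ge> 0\<close> by (simp add: d_def)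
  have "X + s *\<^sub>R B \<in> psd_mats" if s: "\<bar>s\<bar> < d" for s
  proof -
    have sym: "X + s *\<^sub>R B \<in> sym_mats"
      using subspace_sym_mats pd_sym[OF X] B by (intro subspace_add subspace_scale)
    have unit: "0 \<le> v \<bullet> ((X + s *\<^sub>R B) *v v)" if "v \<in> ?K" for v
    proof -
      have "\<bar>s * (v \<bullet> (B *v v))\<bar> \<le> d * M"
        unfolding abs_mult using s u(2)[OF that] \<open>d > 0\<close> by (intro mult_mono) (auto simp: M_def)
      also have "\<dots> \<le> m" using \<open>m > 0\<close> \<open>M \<ge> 0\<close> by (simp add: d_def field_simps)
      also have "m \<le> v \<bullet> (X *v v)" unfolding m_def by (rule w(2)[OF that])
      finally show ?thesis
        by (simp add: matrix_vector_mult_add_rdistrib inner_add_right scaleR_matrix_vector_assoc[symmetric])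
    qed
    have "0 \<le> v \<bullet> ((X + s *\<^sub>R B) *v v)" for v
    proof (cases "v = 0")
      case False
      have "v \<bullet> ((X + s *\<^sub>R B) *v v) =
          (norm v)\<^sup>2 * (((1 / norm v) *\<^sub>R v) \<bullet> ((X + s *\<^sub>R B) *v ((1 / norm v) *\<^sub>R v)))"
        using False by (simp only: matrix_vector_mult_scaleR inner_scaleR_left inner_scaleR_right)
          (simp add: power2_eq_square)
      also have "0 \<le> \<dots>"
        using False by (intro mult_nonneg_nonneg unit) auto
      finally show ?thesis .
    qed simp
    then show ?thesis using sym by (simp add: psd_mats_def)
  qed
  then show ?thesis using \<open>d > 0\<close> by blast
qed

text \<open>A permutation cannot move exactly one point. In the derivative of \<open>det\<close> at
  the identity this removes all permutations other than \<open>id\<close>.\<close>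

lemma permutes_agree_off_point:
  assumes "p permutes UNIV" "\<And>j. j \<noteq> i \<Longrightarrow> p j = j"
  shows "p = id"
proof
  fix j
  have "p i = i"
  proof (rule ccontr)
    assume "p i \<noteq> i"
    then have "p (p i) = p i" by (rule assms(2))
    then show False using injD[OF permutes_inj[OF assms(1)]] \<open>p i \<noteq> i\<close> by blast
  qed
  then show "p j = id j" using assms(2)[of j] by (cases "j = i") auto
qed

lemma DERIV_det_id:
  fixes C :: "real^'n^'n"
  shows "((\<lambda>s. det (mat 1 + s *\<^sub>R C)) has_real_derivative trace C) (at 0)"
proof -
  let ?f = "\<lambda>i p s. (mat 1 + s *\<^sub>R C) $ i $ (p i)"
  have ent: "((\<lambda>s. ?f i p s) has_real_derivative C $ i $ p i) (at 0)" for i and p :: "'n \<Rightarrow> 'n"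
    by (auto intro!: derivative_eq_intros)
  have prod: "(\<Prod>j\<in>UNIV-{i}. ?f j p 0) = (if p = id then 1 else 0)"
    if p: "p permutes UNIV" for p :: "'n \<Rightarrow> 'n" and i
  proof (cases "p = id")
    case False
    then obtain j where "j \<noteq> i" "p j \<noteq> j" using permutes_agree_off_point[OF p, of i] by blast
    then show ?thesis using False by (auto simp: mat_def intro!: prod_zero bexI[of _ j])
  qed (simp add: mat_def)
  have "((\<lambda>s. det (mat 1 + s *\<^sub>R C)) has_real_derivative
      (\<Sum>p\<in>{p. p permutes UNIV}. of_int (sign p) * (\<Sum>i\<in>UNIV. C $ i $ p i * (\<Prod>j\<in>UNIV-{i}. ?f j p 0)))) (at 0)"
    unfolding det_def by (intro DERIV_sum DERIV_cmult has_field_derivative_prod ent)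
  also have "(\<Sum>p\<in>{p. p permutes UNIV}. of_int (sign p) * (\<Sum>i\<in>UNIV. C $ i $ p i * (\<Prod>j\<in>UNIV-{i}. ?f j p 0)))
     = (\<Sum>p\<in>{p. p permutes (UNIV::'n set)}. if p = id then trace C else 0)"
  proof (rule sum.cong, rule refl)
    fix p :: "'n \<Rightarrow> 'n" assume "p \<in> {p. p permutes UNIV}"
    then have "(\<Sum>i\<in>UNIV. C $ i $ p i * (\<Prod>j\<in>UNIV-{i}. ?f j p 0)) = (if p = id then trace C else 0)"
      using prod[of p] by (simp add: trace_def)
    then show "of_int (sign p) * (\<Sum>i\<in>UNIV. C $ i $ p i * (\<Prod>j\<in>UNIV-{i}. ?f j p 0)) = (if p = id then trace C else 0)"
      by (simp add: sign_id)
  qed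
  also have "\<dots> = trace C" by (simp add: permutes_id finite_permutations)
  finally show ?thesis .
qed

text \<open>Jacobi's formula: factoring \<open>X\<close> out of \<open>X + s *\<^sub>R B\<close>
  moves the derivative to the identity matrix.\<close>

lemma DERIV_det:
  fixes X Y B :: "real^'n^'n"
  assumes "Y ** X = mat 1"
  shows "((\<lambda>s. det (X + s *\<^sub>R B)) has_real_derivative det X * trace (Y ** B)) (at 0)"
proof -
  have "X ** Y = mat 1" using assms matrix_left_right_inverse by blast
  then have "X + s *\<^sub>R B = X ** (mat 1 + s *\<^sub>R (Y ** B))" for s
    by (simp add: matrix_add_ldistrib matrix_mul_assoc matrix_scalar_ac flip: scalar_matrix_assoc)
  then have "det (X + s *\<^sub>R B) = det X * det (mat 1 + s *\<^sub>R (Y ** B))" for s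
    by (simp add: det_mul)
  then show ?thesis using DERIV_cmult[OF DERIV_det_id[of "Y ** B"], of "det X"] by simp
qed

text \<open>Outside any ball around \<open>p\<close> the maximum of \<open>f\<close> stays strictly
  below \<open>f p\<close>, so points whose values tend to \<open>f p\<close> must enter the
  ball.\<close>

lemma compact_unique_max_tendsto:
  fixes f :: "'a::metric_space \<Rightarrow> real"
  assumes S: "compact S" and f: "continuous_on S f" and "p \<in> S"
    and uniq: "\<And>y. y \<in> S \<Longrightarrow> f p \<le> f y \<Longrightarrow> y = p"
    and u: "\<And>k. u k \<in> S" and lim: "(\<lambda>k::nat. f (u k)) \<longlonglongrightarrow> f p"
  shows "u \<longlonglongrightarrow> p"
proof (rule tendstoI)
  fix e :: real assume "e > 0"
  let ?K = "S - ball p e"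
  show "\<forall>\<^sub>F k in sequentially. dist (u k) p < e"
  proof (cases "?K = {}")
    case True
    then have "dist (u k) p < e" for k using u[of k] by (auto simp: dist_commute)
    then show ?thesis by simp
  next
    case False
    have "compact ?K" using S by (simp add: compact_diff)
    from continuous_attains_sup[OF this False continuous_on_subset[OF f]] obtain y where
      y: "y \<in> ?K" "\<And>x. x \<in> ?K \<Longrightarrow> f x \<le> f y" by blast
    have "f y < f p" using uniq[of y] y(1) \<open>e > 0\<close> by (metis DiffD1 DiffD2 centre_in_ball not_le)
    from order_tendstoD(1)[OF lim this] show ?thesis
    proof (rule eventually_mono)
      fix k assume "f y < f (u k)"
      then have "u k \<notin> ?K" using y(2)[of "u k"] by linarith
      then show "dist (u k) p < e" using u[of k] by (simp add: dist_commute)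
    qed
  qed
qed

lemma poly_deg_det:
  fixes M :: "('v \<Rightarrow> real) \<Rightarrow> real^'n^'n"
  assumes "\<And>i j. poly_deg U 1 (\<lambda>x. M x $ i $ j)"
  shows "poly_deg U CARD('n) (\<lambda>x. det (M x))"
proof -
  have "poly_deg U (0 + CARD('n) * 1) (\<lambda>x. of_int (sign p) * (\<Prod>i\<in>UNIV. M x $ i $ p i))" for p
    by (intro poly_deg_mult poly_deg_const poly_deg_prod assms finite)
  then show ?thesis unfolding det_def by (intro poly_deg_sum) simp
qed

section \<open>The parametric path\<close>

lemma inner_transpose: "transpose X \<bullet> Y = X \<bullet> transpose (Y :: real^'n^'n)"
  by (simp add: inner_vec_def transpose_def) (rule sum.swap)

section \<open>The constraint map, its adjoint and the perturbed slices\<close>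

locale bounded_spectrahedron =
  fixes A :: "real^'n^'n \<Rightarrow> real^'m" and b :: "real^'m" and X0 :: "real^'n^'n"
  assumes lin: "linear_on_sym A"
    and surj: "A ` sym_mats = UNIV"
    and X0: "X0 \<in> spectrahedron A b"
    and bnd: "bounded (spectrahedron A b)"
begin

text \<open>Extending \<open>A\<close> by zero on skew matrices turns the adjoint on symmetric matrices into the library one.\<close>

definition symA :: "real^'n^'n \<Rightarrow> real^'m" where
  "symA X = A ((1 / 2) *\<^sub>R (X + transpose X))"

definition adj :: "real^'m \<Rightarrow> real^'n^'n" where
  "adj = adjoint symA"

definition ker :: "(real^'n^'n) set" where
  "ker = {B \<in> sym_mats. A B = 0}"

text \<open>For positive \<alpha> this is a positive definite point of the perturbed slice, i.e. a
  Slater point; it also serves as the origin for coordinates on the slice.\<close>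

definition base :: "real \<Rightarrow> real^'n^'n" where
  "base \<alpha> = X0 + \<alpha> *\<^sub>R mat 1"

definition feas :: "real \<Rightarrow> (real^'n^'n) set" where
  "feas \<alpha> = {X \<in> psd_mats. A X = perturbed_rhs A b \<alpha>}"

lemma symA_eq: "X \<in> sym_mats \<Longrightarrow> symA X = A X"
  by (simp add: symA_def sym_mats_def flip: scaleR_2)

lemma symmetric_part: "(1 / 2) *\<^sub>R (X + transpose X) \<in> (sym_mats :: (real^'n^'n) set)"
  by (rule sym_matI) (simp add: transpose_def)

lemma linear_symA: "linear symA"
proof (rule linearI)
  fix X Y :: "real^'n^'n" and c :: real
  let ?s = "\<lambda>X::real^'n^'n. (1 / 2) *\<^sub>R (X + transpose X)"
  have "?s (X + Y) = ?s X + ?s Y" "?s (c *\<^sub>R X) = c *\<^sub>R ?s X"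
    by (simp_all add: vec_eq_iff transpose_def algebra_simps)
  then show "symA (X + Y) = symA X + symA Y" "symA (c *\<^sub>R X) = c *\<^sub>R symA X"
    using lin symmetric_part unfolding symA_def linear_on_sym_def by metis+
qed

lemma surj_symA: "surj symA"
proof -
  have "range symA = UNIV" using surj symA_eq by (metis UNIV_I image_subset_iff subset_antisym subset_UNIV image_cong rangeI)
  then show ?thesis .
qed

lemma adj_inner: "X \<bullet> adj y = symA X \<bullet> y"
  unfolding adj_def by (rule adjoint_works[OF linear_symA])

lemma linear_adj: "linear adj"
  unfolding adj_def by (rule adjoint_linear[OF linear_symA])

text \<open>\<open>symA\<close> does not change under transposition, so \<open>adj y\<close> and its
  transpose pair alike with every matrix.\<close>

lemma adj_sym: "adj y \<in> sym_mats"
proof -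
  have "X \<bullet> transpose (adj y) = X \<bullet> adj y" for X :: "real^'n^'n"
  proof -
    have "X \<bullet> transpose (adj y) = transpose X \<bullet> adj y" by (rule inner_transpose[symmetric])
    also have "\<dots> = X \<bullet> adj y" by (simp add: adj_inner symA_def add.commute)
    finally show ?thesis .
  qed
  then have "transpose (adj y) = adj y" using vector_eq_ldot by blast
  then show ?thesis by (simp add: sym_mats_def)
qed

text \<open>The difference of two candidates for the description is itself a symmetric test matrix,
  and testing with it gives norm zero.\<close>

lemma sym_adjoint_eq: "sym_adjoint A y = adj y"
  unfolding sym_adjoint_def
proof (rule the_equality)
  show "adj y \<in> sym_mats \<and> (\<forall>X\<in>sym_mats. trace (X ** adj y) = A X \<bullet> y)"
    using adj_sym trace_mult_sym[OF adj_sym] adj_inner symA_eq by auto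
  fix Z assume Z: "Z \<in> sym_mats \<and> (\<forall>X\<in>sym_mats. trace (X ** Z) = A X \<bullet> y)"
  let ?D = "Z - adj y"
  have D: "?D \<in> sym_mats" using Z adj_sym subspace_sym_mats by (intro subspace_diff) auto
  then have "?D \<bullet> Z = A ?D \<bullet> y" using Z trace_mult_sym[of Z ?D] by auto
  moreover have "?D \<bullet> adj y = A ?D \<bullet> y" using adj_inner[of ?D y] symA_eq[OF D] by simp
  ultimately have "?D \<bullet> ?D = 0" by (simp add: inner_diff_right)
  then show "Z = adj y" by simp
qed

lemma inj_adj: "inj adj"
  unfolding adj_def using surj_symA by (simp add: linear_symA)

lemma ker_sym: "B \<in> ker \<Longrightarrow> B \<in> sym_mats"
  and symA_ker: "B \<in> ker \<Longrightarrow> symA B = 0"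
  by (auto simp: ker_def symA_eq)

lemma kerI: "B \<in> sym_mats \<Longrightarrow> symA B = 0 \<Longrightarrow> B \<in> ker"
  by (simp add: ker_def symA_eq)

lemma subspace_ker: "subspace ker"
proof -
  have "ker = sym_mats \<inter> symA -` {0}" by (auto simp: ker_sym symA_ker intro: kerI)
  then show ?thesis
    using subspace_inter[OF subspace_sym_mats linear_subspace_vimage[OF linear_symA subspace_single_0]] by simp
qed

lemma adj_orthogonal_ker: "B \<in> ker \<Longrightarrow> adj y \<bullet> B = 0"
  using adj_inner[of B y] by (simp add: symA_ker inner_commute)

text \<open>Within the symmetric matrices the orthogonal complement of \<open>ker\<close> lies in
  the range of \<open>adj\<close>. Surjectivity makes \<open>symA \<circ> adj\<close> invertible, so
  the normal equations have a solution \<open>y\<close>, whose residual lies in \<open>ker\<close>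
  and is orthogonal to itself.\<close>

lemma orthogonal_ker_imp_adj:
  assumes Z: "Z \<in> sym_mats" and orth: "\<And>B. B \<in> ker \<Longrightarrow> Z \<bullet> B = 0"
  shows "\<exists>y. Z = adj y"
proof -
  have lin': "linear (symA \<circ> adj)" using linear_compose[OF linear_adj linear_symA] .
  have "y = 0" if "symA (adj y) = 0" for y
  proof -
    have "adj y \<bullet> adj y = 0" using adj_inner[of "adj y" y] that by simp
    then show ?thesis using inj_adj linear_0[OF linear_adj] by (metis inj_eq inner_eq_zero_iff)
  qed
  then have "inj (symA \<circ> adj)" using linear_injective_0[OF lin'] by auto
  then have "surj (symA \<circ> adj)" using linear_injective_imp_surjective[OF lin'] by blast
  then obtain y where y: "symA (adj y) = symA Z" by (metis comp_apply surjD)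
  let ?D = "Z - adj y"
  have D: "?D \<in> ker"
  proof (rule kerI)
    show "?D \<in> sym_mats" using Z adj_sym subspace_sym_mats by (intro subspace_diff)
    show "symA ?D = 0" using y by (simp add: linear_diff[OF linear_symA])
  qed
  have "?D \<bullet> ?D = 0"
    using orth[OF D] adj_orthogonal_ker[OF D, of y] by (simp add: inner_diff_left)
  then show ?thesis by (intro exI[of _ y]) simp
qed

lemma X0_psd: "X0 \<in> psd_mats" and A_X0: "A X0 = b"
  using X0 by (auto simp: spectrahedron_def)

lemma base_sym: "base \<alpha> \<in> sym_mats"
  unfolding base_def using subspace_sym_mats psd_sym[OF X0_psd] sym_mat_1
  by (intro subspace_add subspace_scale)

lemma symA_base: "symA (base \<alpha>) = perturbed_rhs A b \<alpha>"
  unfolding base_def perturbed_rhs_def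
  using linear_symA A_X0 symA_eq[OF psd_sym[OF X0_psd]] symA_eq[OF sym_mat_1]
  by (simp add: linear_add linear_cmul)

lemma feas_iff: "X \<in> feas \<alpha> \<longleftrightarrow> X \<in> psd_mats \<and> X - base \<alpha> \<in> ker"
proof (cases "X \<in> psd_mats")
  case True
  then have X: "X \<in> sym_mats" by (rule psd_sym)
  have "X - base \<alpha> \<in> sym_mats" using X base_sym subspace_sym_mats by (intro subspace_diff)
  then have "X - base \<alpha> \<in> ker \<longleftrightarrow> symA (X - base \<alpha>) = 0"
    using kerI symA_ker by blast
  also have "\<dots> \<longleftrightarrow> A X = perturbed_rhs A b \<alpha>"
    by (simp add: linear_diff[OF linear_symA] symA_base symA_eq[OF X])
  finally show ?thesis using True by (simp add: feas_def)
qed (simp add: feas_def)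

lemma feas_psd: "X \<in> feas \<alpha> \<Longrightarrow> X \<in> psd_mats"
  by (simp add: feas_def)

lemma pd_base: "0 < \<alpha> \<Longrightarrow> pos_def_mat (base \<alpha>)"
  unfolding base_def by (subst add.commute) (intro pd_add_psd pd_scale pd_mat_1 X0_psd)

lemma base_feas: "0 < \<alpha> \<Longrightarrow> base \<alpha> \<in> feas \<alpha>"
  by (simp add: feas_iff pd_imp_psd[OF pd_base] subspace_0[OF subspace_ker])

text \<open>A nonzero \<open>D\<close> would be a recession direction of the spectrahedron, against
  its boundedness.\<close>

lemma psd_ker_trivial:
  assumes D: "D \<in> psd_mats" "symA D = 0"
  shows "D = 0"
proof (rule ccontr)
  assume "D \<noteq> 0"
  obtain R where R: "\<And>X. X \<in> spectrahedron A b \<Longrightarrow> norm X \<le> R"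
    using bnd by (auto simp: bounded_iff)
  \<comment> \<open>The step \<open>s *\<^sub>R D\<close> has length
    \<open>\<bar>R\<bar> + norm X0 + 1\<close>, enough to leave the ball of radius \<open>R\<close>
    from \<open>X0\<close>.\<close>
  define s where "s = (\<bar>R\<bar> + norm X0 + 1) / norm D"
  have "s \<ge> 0" by (simp add: s_def)
  have psd: "X0 + s *\<^sub>R D \<in> psd_mats" using X0_psd D(1) \<open>s \<ge> 0\<close> by (intro psd_add psd_scale)
  have "A (X0 + s *\<^sub>R D) = symA (X0 + s *\<^sub>R D)" using symA_eq[OF psd_sym[OF psd]] by simp
  also have "\<dots> = b"
    using linear_symA D(2) symA_eq[OF psd_sym[OF X0_psd]] A_X0 by (simp add: linear_add linear_cmul)
  finally have "norm (X0 + s *\<^sub>R D) \<le> R" using psd by (intro R) (simp add: spectrahedron_def)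
  moreover have "norm (s *\<^sub>R D) \<le> norm (X0 + s *\<^sub>R D) + norm X0"
    using norm_triangle_ineq4[of "X0 + s *\<^sub>R D" X0] by simp
  moreover have "norm (s *\<^sub>R D) = \<bar>R\<bar> + norm X0 + 1"
    using \<open>D \<noteq> 0\<close> by (simp add: s_def)
  ultimately show False by linarith
qed

text \<open>Because the cone meets the kernel only in zero, a feasible matrix is controlled by its
  image under \<open>symA\<close>. This makes boundedness of the spectrahedron carry over to all
  slices, uniformly for bounded \<alpha>.\<close>

lemma feas_bounded: "\<exists>R. \<forall>\<alpha> X. \<bar>\<alpha>\<bar> \<le> c \<longrightarrow> X \<in> feas \<alpha> \<longrightarrow> norm X \<le> R"
proof -
  obtain C where C: "C \<ge> 0" "\<And>X. X \<in> psd_mats \<Longrightarrow> norm X \<le> C * norm (symA X)"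
    using linear_psd_norm_bound[OF linear_symA psd_ker_trivial] by blast
  have "norm X \<le> C * (norm b + c * norm (A (mat 1)))" if "\<bar>\<alpha>\<bar> \<le> c" "X \<in> feas \<alpha>" for \<alpha> X
  proof -
    have "norm X \<le> C * norm (symA X)" using that(2) by (intro C(2) feas_psd)
    also have "symA X = b + \<alpha> *\<^sub>R A (mat 1)"
      using that(2) symA_eq[OF psd_sym] by (simp add: feas_def perturbed_rhs_def)
    also have "norm (b + \<alpha> *\<^sub>R A (mat 1)) \<le> norm b + c * norm (A (mat 1))"
      using that(1) by (intro norm_triangle_le) (simp add: mult_right_mono)
    finally show ?thesis using C(1) by (simp add: mult_left_mono)
  qed
  then show ?thesis by blast
qed

lemma closed_affine: "closed {X. X - base \<alpha> \<in> ker}"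
proof -
  have "{X. X - base \<alpha> \<in> ker} = (\<lambda>X. X - base \<alpha>) -` ker" by auto
  moreover have "continuous_on UNIV (\<lambda>X. X - base \<alpha>)" by (intro continuous_intros)
  ultimately show ?thesis
    using closed_subspace[OF subspace_ker] continuous_closed_vimage
    by (metis continuous_on_eq_continuous_at open_UNIV iso_tuple_UNIV_I)
qed

lemma compact_feas: "compact (feas \<alpha>)"
proof -
  have "feas \<alpha> = psd_mats \<inter> {X. X - base \<alpha> \<in> ker}" by (auto simp: feas_iff)
  then have "closed (feas \<alpha>)" using closed_Int[OF closed_psd closed_affine] by metis
  moreover obtain R where "\<And>X. X \<in> feas \<alpha> \<Longrightarrow> norm X \<le> R"
    using feas_bounded[of "\<bar>\<alpha>\<bar>"] by blast
  then have "bounded (feas \<alpha>)" by (auto simp: bounded_iff)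
  ultimately show ?thesis by (simp add: compact_eq_bounded_closed)
qed

section \<open>Existence and uniqueness of path points\<close>

lemma path_system_iff:
  "path_system A b \<alpha> (X, y, Z) \<longleftrightarrow>
    Z = adj y \<and> A X = perturbed_rhs A b \<alpha> \<and> Z ** X = \<alpha> *\<^sub>R mat 1 \<and> pos_def_mat X \<and> pos_def_mat Z"
  by (auto simp: sym_adjoint_eq)

lemma pd_feas_iff: "pos_def_mat X \<Longrightarrow> A X = perturbed_rhs A b \<alpha> \<longleftrightarrow> X \<in> feas \<alpha>"
  by (simp add: feas_def pd_imp_psd)

text \<open>\<open>X1 - X2\<close> lies in the kernel and \<open>Z1 - Z2\<close> in the range of the
  adjoint, so the two are orthogonal and \<open>inverse_pair_unique\<close> applies.\<close>

lemma path_system_unique: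
  assumes "0 < \<alpha>" and 1: "path_system A b \<alpha> (X1, y1, Z1)" and 2: "path_system A b \<alpha> (X2, y2, Z2)"
  shows "(X1, y1, Z1) = (X2, y2, Z2)"
proof -
  note 1 = 1[unfolded path_system_iff] and 2 = 2[unfolded path_system_iff]
  have "X1 - base \<alpha> \<in> ker" "X2 - base \<alpha> \<in> ker" using 1 2 pd_feas_iff feas_iff by blast+
  then have "(X1 - base \<alpha>) - (X2 - base \<alpha>) \<in> ker" by (rule subspace_diff[OF subspace_ker])
  then have D: "X1 - X2 \<in> ker" by simp
  have "(Z1 - Z2) \<bullet> (X1 - X2) = 0"
    using 1 2 adj_orthogonal_ker[OF D] by (simp add: inner_diff_left)
  then have X: "X1 = X2" using 1 2 \<open>0 < \<alpha>\<close> by (intro inverse_pair_unique[of X1 Z1 X2 Z2 \<alpha>]) auto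
  have "Z1 ** X1 = Z2 ** X1" using 1 2 X by metis
  then have "Z1 ** X1 ** Z1 = Z2 ** X1 ** Z1" by simp
  moreover have "X1 ** Z1 = \<alpha> *\<^sub>R mat 1" using inverse_pair_commute[of Z1 X1 \<alpha>] 1 \<open>0 < \<alpha>\<close> by blast
  ultimately have "\<alpha> *\<^sub>R Z1 = \<alpha> *\<^sub>R Z2"
    by (simp add: matrix_mul_assoc[symmetric] matrix_scalar_ac scalar_matrix_assoc[symmetric])
  then have "Z1 = Z2" using \<open>0 < \<alpha>\<close> by simp
  moreover from this have "y1 = y2" using 1 2 inj_adj by (metis injD)
  ultimately show ?thesis using X by simp
qed

text \<open>First-order conditions, stated for \<open>det\<close> rather than its logarithm because
  \<open>det\<close> is a polynomial. Comparison with \<open>base \<alpha>\<close> makes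
  \<open>X\<close> positive definite; vanishing of the derivative along \<open>ker\<close> makes
  \<alpha> times its inverse orthogonal to \<open>ker\<close>, hence a value of
  \<open>adj\<close>.\<close>

lemma det_max_path:
  assumes "0 < \<alpha>" and X: "X \<in> feas \<alpha>" and max: "\<And>Y. Y \<in> feas \<alpha> \<Longrightarrow> det Y \<le> det X"
  shows "\<exists>y Z. path_system A b \<alpha> (X, y, Z)"
proof -
  have "0 < det X" using max[OF base_feas] pd_det_pos[OF pd_base] \<open>0 < \<alpha>\<close> by fastforce
  then have pd: "pos_def_mat X" using psd_det_nz_imp_pd[OF feas_psd[OF X]] by simp
  obtain Y where Y: "Y ** X = mat 1"
    using \<open>0 < det X\<close> by (metis invertible_det_nz invertible_left_inverse less_irrefl)
  then have XY: "X ** Y = mat 1" using matrix_left_right_inverse by blast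
  have "transpose Y ** X = mat 1"
    using arg_cong[OF XY, of transpose] pd_sym[OF pd] by (simp add: matrix_transpose_mul sym_mats_def)
  then have Ysym: "Y \<in> sym_mats"
    using XY by (metis (mono_tags, lifting) mem_Collect_eq matrix_mul_assoc matrix_mul_lid matrix_mul_rid sym_mats_def)
  have "0 < v \<bullet> (Y *v v)" if "v \<noteq> 0" for v
  proof -
    have v: "v = X *v (Y *v v)" by (simp add: matrix_vector_mul_assoc XY)
    then have "Y *v v \<noteq> 0" using that by (metis matrix_vector_mult_0_right)
    then have "0 < (Y *v v) \<bullet> (X *v (Y *v v))" by (rule pd_pos[OF pd])
    then show ?thesis using v by (simp add: inner_commute)
  qed
  then have Ypd: "pos_def_mat Y" using Ysym by (simp add: pos_def_mat_def)
  define Z where "Z = \<alpha> *\<^sub>R Y"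
  have "Y \<bullet> B = 0" if B: "B \<in> ker" for B
  proof -
    obtain d where d: "d > 0" "\<And>s. \<bar>s\<bar> < d \<Longrightarrow> X + s *\<^sub>R B \<in> psd_mats"
      using pd_perturb[OF pd ker_sym[OF B]] by blast
    have "X + s *\<^sub>R B \<in> feas \<alpha>" if "\<bar>s\<bar> < d" for s
    proof -
      have "(X - base \<alpha>) + s *\<^sub>R B \<in> ker"
        using X B subspace_ker by (intro subspace_add subspace_scale) (auto simp: feas_iff)
      then show ?thesis using d(2)[OF that] by (simp add: feas_iff algebra_simps)
    qed
    then have "\<forall>s. \<bar>0 - s\<bar> < d \<longrightarrow> det (X + s *\<^sub>R B) \<le> det (X + 0 *\<^sub>R B)" using max by simp
    from DERIV_local_max[OF DERIV_det[OF Y] d(1) this] have "trace (Y ** B) = 0"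
      using \<open>0 < det X\<close> by simp
    then show ?thesis using trace_mult_sym[OF ker_sym[OF B]] by simp
  qed
  then have "Z \<bullet> B = 0" if "B \<in> ker" for B using that by (simp add: Z_def)
  moreover have "pos_def_mat Z" unfolding Z_def using Ypd \<open>0 < \<alpha>\<close> by (rule pd_scale)
  ultimately obtain y where "Z = adj y" using orthogonal_ker_imp_adj pd_sym by blast
  moreover have "Z ** X = \<alpha> *\<^sub>R mat 1" using Y by (simp add: Z_def flip: scalar_matrix_assoc)
  ultimately show ?thesis
    using \<open>pos_def_mat Z\<close> pd X
    by (intro exI[of _ y] exI[of _ Z]) (simp add: path_system_iff pd_feas_iff del: path_system.simps)
qed

lemma det_max_exists:
  assumes "0 < \<alpha>"
  shows "\<exists>X\<in>feas \<alpha>. \<forall>Y\<in>feas \<alpha>. det Y \<le> det X"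
  using continuous_attains_sup[OF compact_feas _ continuous_on_det] base_feas[OF assms] by blast

definition Xp :: "real \<Rightarrow> real^'n^'n" where "Xp \<alpha> = fst (path_point A b \<alpha>)"
definition yp :: "real \<Rightarrow> real^'m" where "yp \<alpha> = fst (snd (path_point A b \<alpha>))"
definition Zp :: "real \<Rightarrow> real^'n^'n" where "Zp \<alpha> = snd (snd (path_point A b \<alpha>))"

lemma path_point_eq: "path_point A b \<alpha> = (Xp \<alpha>, yp \<alpha>, Zp \<alpha>)"
  by (simp add: Xp_def yp_def Zp_def)

lemma path_system_path_point:
  assumes "0 < \<alpha>"
  shows "path_system A b \<alpha> (Xp \<alpha>, yp \<alpha>, Zp \<alpha>)"
proof -
  obtain X y Z where "path_system A b \<alpha> (X, y, Z)"
    using det_max_exists[OF assms] det_max_path[OF assms] by blast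
  then have "\<exists>!p. path_system A b \<alpha> p"
    using path_system_unique[OF assms] by (metis prod_cases3)
  then have "path_system A b \<alpha> (path_point A b \<alpha>)" unfolding path_point_def by (rule theI')
  then show ?thesis by (simp only: path_point_eq)
qed

lemma path_pointI: "0 < \<alpha> \<Longrightarrow> path_system A b \<alpha> (X, y, Z) \<Longrightarrow> X = Xp \<alpha> \<and> y = yp \<alpha> \<and> Z = Zp \<alpha>"
  using path_system_unique[OF _ path_system_path_point] by (metis prod.inject)

context
  fixes \<alpha> :: real
  assumes \<alpha>: "0 < \<alpha>"
begin

lemmas path = path_system_path_point[OF \<alpha>, unfolded path_system_iff]

lemma Zp_eq: "Zp \<alpha> = adj (yp \<alpha>)"
  and Zp_Xp: "Zp \<alpha> ** Xp \<alpha> = \<alpha> *\<^sub>R mat 1"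
  and pd_Xp: "pos_def_mat (Xp \<alpha>)"
  and pd_Zp: "pos_def_mat (Zp \<alpha>)"
  and Xp_feas: "Xp \<alpha> \<in> feas \<alpha>"
  using path by (auto simp: pd_feas_iff)

text \<open>Every maximiser of \<open>det\<close> solves the path system, so uniqueness of
  maximisers is inherited from that system instead of from concavity.\<close>

lemma det_max_unique:
  assumes "Y \<in> feas \<alpha>" "det (Xp \<alpha>) \<le> det Y"
  shows "Y = Xp \<alpha>"
proof -
  obtain X where X: "X \<in> feas \<alpha>" "\<forall>Y\<in>feas \<alpha>. det Y \<le> det X" using det_max_exists[OF \<alpha>] by blast
  then have "X = Xp \<alpha>" using det_max_path[OF \<alpha> X(1)] path_pointI[OF \<alpha>] by blast
  then have "\<forall>W\<in>feas \<alpha>. det W \<le> det Y" using X(2) assms(2) by (metis order_trans)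
  then show ?thesis using det_max_path[OF \<alpha> assms(1)] path_pointI[OF \<alpha>] by blast
qed

lemma det_Xp_max: "Y \<in> feas \<alpha> \<Longrightarrow> det Y \<le> det (Xp \<alpha>)"
  using det_max_unique[of Y] by (metis linear order_refl)

section \<open>Estimates along the path\<close>

text \<open>\<open>Zp \<alpha>\<close> is orthogonal to the kernel element
  \<open>Xp \<alpha> - X - \<alpha> *\<^sub>R mat 1\<close>, and its pairing with
  \<open>Xp \<alpha>\<close> is \<alpha> times the matrix size. Both summands on the left are
  nonnegative, so each is bounded by the right-hand side.\<close>

lemma Zp_inner:
  assumes "X \<in> spectrahedron A b"
  shows "Zp \<alpha> \<bullet> X + \<alpha> * trace (Zp \<alpha>) = \<alpha> * CARD('n)"
proof -
  have X: "X \<in> psd_mats" "A X = b" using assms by (auto simp: spectrahedron_def)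
  have "Xp \<alpha> - base \<alpha> \<in> ker" using Xp_feas by (simp add: feas_iff)
  moreover have "X - X0 \<in> ker"
  proof (rule kerI)
    show "X - X0 \<in> sym_mats" using X X0_psd psd_sym subspace_sym_mats by (intro subspace_diff) auto
    show "symA (X - X0) = 0"
      using X(2) A_X0 symA_eq[OF psd_sym[OF X(1)]] symA_eq[OF psd_sym[OF X0_psd]]
      by (simp add: linear_diff[OF linear_symA])
  qed
  ultimately have "Zp \<alpha> \<bullet> (Xp \<alpha> - base \<alpha>) = 0" "Zp \<alpha> \<bullet> (X - X0) = 0"
    unfolding Zp_eq by (simp_all add: adj_orthogonal_ker)
  then have "Zp \<alpha> \<bullet> Xp \<alpha> = Zp \<alpha> \<bullet> X + \<alpha> * (Zp \<alpha> \<bullet> mat 1)"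
    by (simp add: base_def inner_diff_right inner_add_right)
  moreover have "Zp \<alpha> \<bullet> Xp \<alpha> = \<alpha> * CARD('n)"
    using trace_mult_sym[OF pd_sym[OF pd_Xp], of "Zp \<alpha>"] Zp_Xp by (simp add: trace_def mat_def mult.commute)
  moreover have "Zp \<alpha> \<bullet> mat 1 = trace (Zp \<alpha>)"
    using trace_mult_sym[OF sym_mat_1, of "Zp \<alpha>"] by simp
  ultimately show ?thesis by simp
qed

lemma trace_Zp_le: "trace (Zp \<alpha>) \<le> CARD('n)"
proof -
  have "0 \<le> Zp \<alpha> \<bullet> X0" by (rule inner_psd_nonneg[OF pd_imp_psd[OF pd_Zp] X0_psd])
  then have "\<alpha> * trace (Zp \<alpha>) \<le> \<alpha> * CARD('n)" using Zp_inner[OF X0] by linarith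
  then show ?thesis using \<alpha> by simp
qed

text \<open>Dropping the trace term of \<open>Zp_inner\<close> bounds the pairing with
  \<open>X\<close> by a multiple of \<alpha>, and \<open>psd_form_le_inner\<close> cancels that
  \<alpha>. The constant is free of \<alpha>, so the estimate survives the limit.\<close>

lemma spectrahedron_le_Xp:
  assumes X: "X \<in> spectrahedron A b"
  shows "v \<bullet> (X *v v) \<le> CARD('n) * (v \<bullet> (Xp \<alpha> *v v))"
proof -
  have psd: "X \<in> psd_mats" using X by (simp add: spectrahedron_def)
  have "0 \<le> trace (Zp \<alpha>)"
    using inner_psd_nonneg[OF pd_imp_psd[OF pd_Zp] pd_imp_psd[OF pd_mat_1]]
      trace_mult_sym[OF sym_mat_1, of "Zp \<alpha>"] by simp
  then have "Zp \<alpha> \<bullet> X \<le> \<alpha> * CARD('n)" using Zp_inner[OF X] \<alpha> mult_nonneg_nonneg[of \<alpha> "trace (Zp \<alpha>)"] by linarith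
  then have "(Zp \<alpha> \<bullet> X) * (v \<bullet> (Xp \<alpha> *v v)) \<le> \<alpha> * CARD('n) * (v \<bullet> (Xp \<alpha> *v v))"
    by (rule mult_right_mono) (rule psd_nonneg[OF pd_imp_psd[OF pd_Xp]])
  moreover have "\<alpha> * (v \<bullet> (X *v v)) \<le> (Zp \<alpha> \<bullet> X) * (v \<bullet> (Xp \<alpha> *v v))"
    by (rule psd_form_le_inner[OF pd_Zp pd_Xp Zp_Xp \<alpha> psd])
  ultimately have "\<alpha> * (v \<bullet> (X *v v)) \<le> \<alpha> * (CARD('n) * (v \<bullet> (Xp \<alpha> *v v)))" by (simp only: mult.assoc)
  then show ?thesis using \<alpha> by simp
qed

end

section \<open>Convergence\<close>

definition on_basis :: "(real^'n^'n) set" where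
  "on_basis = (SOME Bs. Bs \<subseteq> ker \<and> pairwise orthogonal Bs \<and> (\<forall>B\<in>Bs. norm B = 1) \<and>
     independent Bs \<and> span Bs = ker)"

lemma on_basis:
  "on_basis \<subseteq> ker" "pairwise orthogonal on_basis" "B \<in> on_basis \<Longrightarrow> norm B = 1"
  "span on_basis = ker" "finite on_basis"
proof -
  have "\<exists>Bs. Bs \<subseteq> ker \<and> pairwise orthogonal Bs \<and> (\<forall>B\<in>Bs. norm B = 1) \<and>
     independent Bs \<and> span Bs = ker"
    using orthonormal_basis_subspace[OF subspace_ker] by metis
  from someI_ex[OF this] have *: "on_basis \<subseteq> ker \<and> pairwise orthogonal on_basis \<and>
     (\<forall>B\<in>on_basis. norm B = 1) \<and> independent on_basis \<and> span on_basis = ker"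
    unfolding on_basis_def .
  then show "on_basis \<subseteq> ker" "pairwise orthogonal on_basis" "B \<in> on_basis \<Longrightarrow> norm B = 1"
    "span on_basis = ker" "finite on_basis"
    by (auto intro: independent_imp_finite)
qed

text \<open>Coordinates: the variable \<open>None\<close> is the path parameter, \<open>Some B\<close> the coefficient of \<open>B\<close>.\<close>

definition vars :: "(real^'n^'n) option set" where
  "vars = Some ` on_basis"

definition mat_of :: "((real^'n^'n) option \<Rightarrow> real) \<Rightarrow> real^'n^'n" where
  "mat_of x = base (x None) + (\<Sum>B\<in>on_basis. x (Some B) *\<^sub>R B)"

definition coords :: "real \<Rightarrow> real^'n^'n \<Rightarrow> (real^'n^'n) option \<Rightarrow> real" where
  "coords \<alpha> X = (\<lambda>v. case v of None \<Rightarrow> \<alpha> | Some B \<Rightarrow> (X - base \<alpha>) \<bullet> B)"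

lemma coords_simps [simp]: "coords \<alpha> X None = \<alpha>" "coords \<alpha> X (Some B) = (X - base \<alpha>) \<bullet> B"
  by (simp_all add: coords_def)

lemma finite_vars: "finite vars" and None_vars: "None \<notin> vars"
  by (auto simp: vars_def on_basis)

lemma mat_of_coords: "X \<in> feas \<alpha> \<Longrightarrow> mat_of (coords \<alpha> X) = X"
  using orthonormal_basis_expand[OF on_basis(2,3) _ on_basis(5), of "X - base \<alpha>"]
  by (simp add: mat_of_def on_basis(4) feas_iff)

lemma mat_of_upd:
  assumes "B \<in> on_basis"
  shows "mat_of (x(Some B := s)) = mat_of x + (s - x (Some B)) *\<^sub>R B"
proof -
  have "(\<Sum>C\<in>on_basis. (x(Some B := s)) (Some C) *\<^sub>R C)
      = (\<Sum>C\<in>on_basis. x (Some C) *\<^sub>R C + (if C = B then (s - x (Some B)) *\<^sub>R B else 0))"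
    by (intro sum.cong) (auto simp: algebra_simps)
  also have "\<dots> = (\<Sum>C\<in>on_basis. x (Some C) *\<^sub>R C) + (s - x (Some B)) *\<^sub>R B"
    using assms on_basis(5) by (simp add: sum.distrib)
  finally show ?thesis by (simp add: mat_of_def)
qed

lemma mat_of_entry_poly: "poly_deg (insert None vars) 1 (\<lambda>x. mat_of x $ i $ j)"
proof -
  let ?U = "insert None vars"
  have U: "finite ?U" using finite_vars by simp
  have var: "poly_deg ?U (1 + 0) (\<lambda>x. x v * c)" if "v \<in> ?U" for v c
    using U that by (intro poly_deg_mult poly_deg_var poly_deg_const) auto
  have "poly_deg ?U 1 (\<lambda>x. (X0 $ i $ j + x None * (mat 1 :: real^'n^'n) $ i $ j) +
      (\<Sum>B\<in>on_basis. x (Some B) * B $ i $ j))"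
    using var by (intro poly_deg.add poly_deg_sum poly_deg_const) (auto simp: vars_def)
  then show ?thesis by (simp add: mat_of_def base_def)
qed

definition dets :: "((real^'n^'n) option \<Rightarrow> real) \<Rightarrow> real" where
  "dets x = det (mat_of x)"

lemma dets_poly: "poly_deg (insert None vars) CARD('n) dets"
  using poly_deg_det[OF mat_of_entry_poly] by (simp add: dets_def[abs_def])

text \<open>Chosen by \<open>SOME\<close> because only its degree bound and its derivative property
  are used.\<close>

definition grad :: "(real^'n^'n) option \<Rightarrow> ((real^'n^'n) option \<Rightarrow> real) \<Rightarrow> real" where
  "grad v = (SOME g. poly_deg (insert None vars) CARD('n) g \<and>
     (\<forall>x. ((\<lambda>s. dets (x(v := s))) has_real_derivative g x) (at (x v))))"

lemma grad:
  assumes "v \<in> vars"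
  shows "poly_deg (insert None vars) CARD('n) (grad v)"
    "((\<lambda>s. dets (x(v := s))) has_real_derivative grad v x) (at (x v))"
proof -
  have "\<exists>g. poly_deg (insert None vars) CARD('n) g \<and>
     (\<forall>x. ((\<lambda>s. dets (x(v := s))) has_real_derivative g x) (at (x v)))"
    using dets_poly finite_vars assms by (intro poly_deg_partial) auto
  from someI_ex[OF this] show "poly_deg (insert None vars) CARD('n) (grad v)"
    "((\<lambda>s. dets (x(v := s))) has_real_derivative grad v x) (at (x v))"
    unfolding grad_def[symmetric] by (rule conjunct1, rule spec[OF conjunct2])
qed

text \<open>The exponent exceeds the degree of \<open>det\<close>, so that the critical point equations of the
  penalised determinant determine a finite-dimensional quotient of the polynomial ring.\<close>

definition pen :: "((real^'n^'n) option \<Rightarrow> real) \<Rightarrow> real" where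
  "pen x = (\<Sum>B\<in>on_basis. x (Some B) ^ (CARD('n) + 2) / (real CARD('n) + 2))"

text \<open>The penalty weight \<open>1 / Suc k\<close> tends to zero with growing \<open>k\<close>,
  so that maximisers approach that of \<open>det\<close>.\<close>

definition obj :: "nat \<Rightarrow> real \<Rightarrow> real^'n^'n \<Rightarrow> real" where
  "obj k \<alpha> X = det X - pen (coords \<alpha> X) / real (Suc k)"

lemma continuous_on_pen: "continuous_on S (\<lambda>X. pen (coords \<alpha> X))"
  unfolding pen_def by (auto intro!: continuous_intros)

lemma continuous_on_obj: "continuous_on S (obj k \<alpha>)"
  unfolding obj_def by (intro continuous_intros continuous_on_det continuous_on_pen) simp

definition Xk :: "nat \<Rightarrow> real \<Rightarrow> real^'n^'n" where
  "Xk k \<alpha> = (SOME X. X \<in> feas \<alpha> \<and> (\<forall>Y\<in>feas \<alpha>. obj k \<alpha> Y \<le> obj k \<alpha> X))"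

context
  fixes \<alpha> :: real
  assumes \<alpha>: "0 < \<alpha>"
begin

lemma Xk: "Xk k \<alpha> \<in> feas \<alpha>" "Y \<in> feas \<alpha> \<Longrightarrow> obj k \<alpha> Y \<le> obj k \<alpha> (Xk k \<alpha>)"
proof -
  have "feas \<alpha> \<noteq> {}" using base_feas[OF \<alpha>] by blast
  then have "\<exists>X. X \<in> feas \<alpha> \<and> (\<forall>Y\<in>feas \<alpha>. obj k \<alpha> Y \<le> obj k \<alpha> X)"
    using continuous_attains_sup[OF compact_feas _ continuous_on_obj] by blast
  from someI_ex[OF this] show "Xk k \<alpha> \<in> feas \<alpha>" "Y \<in> feas \<alpha> \<Longrightarrow> obj k \<alpha> Y \<le> obj k \<alpha> (Xk k \<alpha>)"
    unfolding Xk_def[symmetric] by blast+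
qed

text \<open>If \<open>C\<close> bounds the penalty on the slice, comparing objectives at
  \<open>Xk\<close> and \<open>Xp\<close> puts \<open>det (Xk k \<alpha>)\<close> within
  \<open>2 * C / Suc k\<close> of the maximum; uniqueness of the maximiser then gives
  convergence.\<close>

lemma Xk_tendsto: "(\<lambda>k. Xk k \<alpha>) \<longlonglongrightarrow> Xp \<alpha>"
proof (rule compact_unique_max_tendsto[OF compact_feas continuous_on_det Xp_feas[OF \<alpha>] _ Xk(1)])
  show "Y = Xp \<alpha>" if "Y \<in> feas \<alpha>" "det (Xp \<alpha>) \<le> det Y" for Y
    using det_max_unique[OF \<alpha> that] .
  \<comment> \<open>The exponent in \<open>pen\<close> may be odd, so the penalty need not be
    nonnegative; compactness of the slice bounds its modulus.\<close>
  have "compact ((\<lambda>X. pen (coords \<alpha> X)) ` feas \<alpha>)"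
    by (intro compact_continuous_image continuous_on_pen compact_feas)
  then obtain C where "\<forall>y\<in>(\<lambda>X. pen (coords \<alpha> X)) ` feas \<alpha>. norm y \<le> C"
    using compact_imp_bounded bounded_iff by blast
  then have C: "\<bar>pen (coords \<alpha> X)\<bar> \<le> C" if "X \<in> feas \<alpha>" for X using that by simp
  have lower: "det (Xp \<alpha>) - 2 * C * inverse (real (Suc k)) \<le> det (Xk k \<alpha>)" for k
  proof -
    have "pen (coords \<alpha> (Xp \<alpha>)) - pen (coords \<alpha> (Xk k \<alpha>)) \<le> 2 * C"
      using C[OF Xp_feas[OF \<alpha>]] C[OF Xk(1)[of k]] by linarith
    then have "(pen (coords \<alpha> (Xp \<alpha>)) - pen (coords \<alpha> (Xk k \<alpha>))) / real (Suc k) \<le> 2 * C / real (Suc k)"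
      by (rule divide_right_mono) simp
    then show ?thesis using Xk(2)[OF Xp_feas[OF \<alpha>], of k] by (simp add: obj_def diff_divide_distrib inverse_eq_divide)
  qed
  have lim: "(\<lambda>k. det (Xp \<alpha>) - 2 * C * inverse (real (Suc k))) \<longlonglongrightarrow> det (Xp \<alpha>) - 2 * C * 0"
    by (intro tendsto_intros LIMSEQ_inverse_real_of_nat)
  show "(\<lambda>k. det (Xk k \<alpha>)) \<longlonglongrightarrow> det (Xp \<alpha>)"
  proof (rule tendsto_sandwich)
    show "(\<lambda>k. det (Xp \<alpha>) - 2 * C * inverse (real (Suc k))) \<longlonglongrightarrow> det (Xp \<alpha>)" using lim by simp
    show "\<forall>\<^sub>F k in sequentially. det (Xp \<alpha>) - 2 * C * inverse (real (Suc k)) \<le> det (Xk k \<alpha>)"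
      using lower by simp
    show "\<forall>\<^sub>F k in sequentially. det (Xk k \<alpha>) \<le> det (Xp \<alpha>)"
      using det_Xp_max[OF \<alpha> Xk(1)] by simp
  qed simp
qed

lemma det_Xk_tendsto: "(\<lambda>k. det (Xk k \<alpha>)) \<longlonglongrightarrow> det (Xp \<alpha>)"
  by (rule continuous_on_tendsto_compose[OF continuous_on_det[of UNIV] Xk_tendsto]) auto

text \<open>Changing one coordinate moves along a kernel element and, by positive definiteness,
  stays feasible for small steps. So the partial derivative of the objective vanishes; the penalty
  contributes the pure power \<open>x v ^ (CARD('n') + 1)\<close> with no other coordinate.\<close>

lemma Xk_critical:
  assumes pd: "pos_def_mat (Xk k \<alpha>)" and v: "v \<in> vars"
  defines "x \<equiv> coords \<alpha> (Xk k \<alpha>)"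
  shows "x v ^ (CARD('n) + 1) = real (Suc k) * grad v x"
proof -
  obtain B where B: "v = Some B" "B \<in> on_basis" using v by (auto simp: vars_def)
  have Bk: "B \<in> ker" using B on_basis(1) by blast
  define F where "F s = dets (x(v := s)) - pen (x(v := s)) / real (Suc k)" for s
  let ?c = "\<Sum>C\<in>on_basis-{B}. x (Some C) ^ (CARD('n) + 2) / (real CARD('n) + 2)"
  have pen_eq: "pen (x(v := s)) = s ^ (CARD('n) + 2) / (real CARD('n) + 2) + ?c" for s
    unfolding pen_def using B on_basis(5) by (subst sum.remove[of _ B]) (auto intro!: sum.cong)
  have "((\<lambda>s. s ^ (CARD('n) + 2) / (real CARD('n) + 2) + ?c) has_real_derivative
      real (CARD('n) + 2) * x v ^ (CARD('n) + 2 - Suc 0) / (real CARD('n) + 2) + 0) (at (x v))"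
    by (intro DERIV_add DERIV_cdivide DERIV_pow DERIV_const)
  moreover have "real (CARD('n) + 2) * x v ^ (CARD('n) + 2 - Suc 0) / (real CARD('n) + 2) + 0 = x v ^ (CARD('n) + 1)"
    by (simp add: divide_eq_eq)
  ultimately have "((\<lambda>s. pen (x(v := s))) has_real_derivative x v ^ (CARD('n) + 1)) (at (x v))"
    unfolding pen_eq by simp
  then have der: "(F has_real_derivative grad v x - x v ^ (CARD('n) + 1) / real (Suc k)) (at (x v))"
    unfolding F_def by (intro DERIV_diff DERIV_cdivide grad(2)[OF v])
  have mat: "mat_of (x(v := s)) = Xk k \<alpha> + (s - x v) *\<^sub>R B" for s
    using mat_of_upd[OF B(2), of x s] mat_of_coords[OF Xk(1)] B(1) by (simp add: x_def)
  obtain d where d: "d > 0" "\<And>s. \<bar>s\<bar> < d \<Longrightarrow> Xk k \<alpha> + s *\<^sub>R B \<in> psd_mats"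
    using pd_perturb[OF pd ker_sym[OF Bk]] by blast
  \<comment> \<open>Orthonormality of the basis ensures that a step along \<open>B\<close> changes
    the coordinate of \<open>B\<close> alone.\<close>
  have F_eq: "F s = obj k \<alpha> (Xk k \<alpha> + (s - x v) *\<^sub>R B)" for s
  proof -
    have "coords \<alpha> (Xk k \<alpha> + (s - x v) *\<^sub>R B) (Some C) = (x(v := s)) (Some C)" if "C \<in> on_basis" for C
    proof (cases "C = B")
      case True
      have "B \<bullet> B = 1" using on_basis(3)[OF B(2)] by (simp add: dot_square_norm)
      then show ?thesis using True B(1) by (simp add: x_def inner_diff_left inner_add_left)
    next
      case False
      then have "B \<bullet> C = 0" using on_basis(2) that B(2) by (auto simp: pairwise_def orthogonal_def)
      then show ?thesis using False B(1) by (simp add: x_def inner_diff_left inner_add_left)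
    qed
    then have "pen (coords \<alpha> (Xk k \<alpha> + (s - x v) *\<^sub>R B)) = pen (x(v := s))"
      unfolding pen_def by (intro sum.cong) simp_all
    then show ?thesis by (simp add: F_def obj_def dets_def mat)
  qed
  have "\<forall>s. \<bar>x v - s\<bar> < d \<longrightarrow> F s \<le> F (x v)"
  proof (intro allI impI)
    fix s assume "\<bar>x v - s\<bar> < d"
    then have psd: "Xk k \<alpha> + (s - x v) *\<^sub>R B \<in> psd_mats" using d(2)[of "s - x v"] by (simp add: abs_minus_commute)
    have "(Xk k \<alpha> - base \<alpha>) + (s - x v) *\<^sub>R B \<in> ker"
      using Xk(1) Bk subspace_ker by (intro subspace_add subspace_scale) (auto simp: feas_iff)
    then have "Xk k \<alpha> + (s - x v) *\<^sub>R B \<in> feas \<alpha>" using psd by (simp add: feas_iff algebra_simps)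
    from Xk(2)[OF this] show "F s \<le> F (x v)" by (simp add: F_eq)
  qed
  from DERIV_local_max[OF der d(1) this] show ?thesis by (simp add: field_simps)
qed

end

text \<open>Elimination applies with \<open>E = CARD('n) + 1\<close>, one more than the degree bound
  of \<open>grad\<close>. The critical equations hold only for large \<open>k\<close>, once
  \<open>det (Xk k \<alpha>)\<close> is positive and \<open>Xk k \<alpha>\<close> thus positive
  definite.\<close>

lemma path_entry_limit:
  fixes z G :: "real \<Rightarrow> real"
  assumes h: "poly_deg (insert None vars) r h" and g: "poly_deg (insert None vars) r g"
    and limh: "\<And>\<alpha>. 0 < \<alpha> \<Longrightarrow> (\<lambda>k. h (coords \<alpha> (Xk k \<alpha>))) \<longlonglongrightarrow> z \<alpha> * G \<alpha>"
    and limg: "\<And>\<alpha>. 0 < \<alpha> \<Longrightarrow> (\<lambda>k. g (coords \<alpha> (Xk k \<alpha>))) \<longlonglongrightarrow> G \<alpha>"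
    and G: "\<And>\<alpha>. 0 < \<alpha> \<Longrightarrow> G \<alpha> \<noteq> 0"
    and cont: "continuous_on {0<..1} z"
    and bnd: "\<And>\<alpha>. 0 < \<alpha> \<Longrightarrow> \<alpha> \<le> 1 \<Longrightarrow> \<bar>z \<alpha>\<bar> \<le> R"
  shows "\<exists>l. (z \<longlongrightarrow> l) (at_right 0)"
proof (rule algebraic_curve_limit[OF finite_vars None_vars grad(1) _ h g])
  show "CARD('n) < CARD('n) + 1" by simp
  fix \<alpha> :: real assume \<alpha>: "0 < \<alpha>"
  have "0 < det (Xp \<alpha>)" by (rule pd_det_pos[OF pd_Xp[OF \<alpha>]])
  from order_tendstoD(1)[OF det_Xk_tendsto[OF \<alpha>] this]
  show "\<forall>\<^sub>F k in sequentially. coords \<alpha> (Xk k \<alpha>) None = \<alpha> \<and>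
    (\<forall>v\<in>vars. coords \<alpha> (Xk k \<alpha>) v ^ (CARD('n) + 1) = real (Suc k) * grad v (coords \<alpha> (Xk k \<alpha>)))"
  proof (rule eventually_mono)
    fix k assume "0 < det (Xk k \<alpha>)"
    then have "pos_def_mat (Xk k \<alpha>)"
      using psd_det_nz_imp_pd[OF feas_psd[OF Xk(1)[OF \<alpha>]]] by simp
    then show "coords \<alpha> (Xk k \<alpha>) None = \<alpha> \<and>
      (\<forall>v\<in>vars. coords \<alpha> (Xk k \<alpha>) v ^ (CARD('n) + 1) = real (Suc k) * grad v (coords \<alpha> (Xk k \<alpha>)))"
      using Xk_critical[OF \<alpha>] by simp
  qed
qed (use assms in auto)

section \<open>Boundedness and continuity of the path\<close>

lemma Xp_bounded: "\<exists>R. \<forall>\<alpha>. 0 < \<alpha> \<longrightarrow> \<alpha> \<le> 1 \<longrightarrow> norm (Xp \<alpha>) \<le> R"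
  using feas_bounded[of 1] Xp_feas by (metis abs_of_pos)

lemma linear_trace: "linear (trace :: real^'n^'n \<Rightarrow> real)"
  by (rule linearI) (simp_all add: trace_def sum.distrib sum_distrib_left)

text \<open>A positive semidefinite matrix of trace zero vanishes, so on the cone the trace controls
  the norm; \<open>trace_Zp_le\<close> bounds the trace.\<close>

lemma Zp_bounded: "\<exists>R. \<forall>\<alpha>. 0 < \<alpha> \<longrightarrow> norm (Zp \<alpha>) \<le> R"
proof -
  have ker: "X = 0" if X: "X \<in> psd_mats" "trace X = 0" for X :: "real^'n^'n"
  proof -
    have "mat 1 \<bullet> X = 0" using X(2) trace_mult_sym[OF sym_mat_1, of X] by (simp add: inner_commute)
    then have "v \<bullet> (X *v v) \<le> 0" for v
      using psd_form_le_inner[OF pd_mat_1 pd_mat_1, of 1 X v] X(1) by simp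
    then have "X *v v = 0" for v
      using psd_zero_form[OF X(1)] psd_nonneg[OF X(1)] by (metis order_antisym)
    then show ?thesis by (simp add: matrix_eq)
  qed
  have "\<exists>C\<ge>0. \<forall>X\<in>psd_mats. norm X \<le> C * norm (trace (X :: real^'n^'n))"
    by (rule linear_psd_norm_bound[OF linear_trace ker])
  then obtain C where C: "C \<ge> 0" "\<forall>X\<in>psd_mats. norm X \<le> C * norm (trace (X :: real^'n^'n))"
    by (elim exE conjE)
  have "norm (Zp \<alpha>) \<le> C * CARD('n)" if \<alpha>: "0 < \<alpha>" for \<alpha>
  proof -
    have "0 \<le> trace (Zp \<alpha>)"
      using inner_psd_nonneg[OF pd_imp_psd[OF pd_Zp[OF \<alpha>]] pd_imp_psd[OF pd_mat_1]]
        trace_mult_sym[OF sym_mat_1, of "Zp \<alpha>"] by simp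
    then have "norm (trace (Zp \<alpha>)) \<le> CARD('n)" using trace_Zp_le[OF \<alpha>] by simp
    then show ?thesis
      using bspec[OF C(2) pd_imp_psd[OF pd_Zp[OF \<alpha>]]] C(1) by (meson mult_left_mono order_trans)
  qed
  then show ?thesis by blast
qed

lemma matrix_mult_tendsto:
  fixes X Z :: "'a \<Rightarrow> real^'n^'n"
  assumes "(X \<longlongrightarrow> l) F" "(Z \<longlongrightarrow> m) F"
  shows "((\<lambda>t. X t ** Z t) \<longlongrightarrow> l ** m) F"
  unfolding matrix_matrix_mult_def
  by (intro vec_tendstoI) (auto intro!: tendsto_intros assms)

lemma range_adj_closed: "closed (range adj)"
  by (rule closed_subspace[OF linear_subspace_image[OF linear_adj subspace_UNIV]])

text \<open>Keeping \<alpha> above \<open>c\<close> makes the limit of \<open>Z ** X\<close>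
  invertible, so the semidefinite limits are positive definite. They solve the path system again,
  and uniqueness puts the limit on the graph.\<close>

lemma path_graph_closed:
  assumes "0 < c"
  shows "closed ((\<lambda>\<alpha>. (\<alpha>, Xp \<alpha>, Zp \<alpha>)) ` {c..1})"
  unfolding closed_sequential_limits
proof (intro allI impI, elim conjE)
  fix u :: "nat \<Rightarrow> real \<times> (real^'n^'n) \<times> (real^'n^'n)" and l
  assume u: "\<forall>k. u k \<in> (\<lambda>\<alpha>. (\<alpha>, Xp \<alpha>, Zp \<alpha>)) ` {c..1}" and lim: "u \<longlonglongrightarrow> l"
  obtain \<alpha> X Z where l: "l = (\<alpha>, X, Z)" by (cases l)
  define a where "a k = fst (u k)" for k
  have a: "c \<le> a k" "a k \<le> 1" and uk: "fst (snd (u k)) = Xp (a k)" "snd (snd (u k)) = Zp (a k)" for k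
    using u by (auto simp: a_def image_iff) (metis fst_conv snd_conv atLeastAtMost_iff)+
  have pos: "0 < a k" for k using a(1)[of k] assms by simp
  have la: "a \<longlonglongrightarrow> \<alpha>" unfolding a_def using tendsto_fst[OF lim] l by simp
  have lX: "(\<lambda>k. Xp (a k)) \<longlonglongrightarrow> X" and lZ: "(\<lambda>k. Zp (a k)) \<longlonglongrightarrow> Z"
    using tendsto_fst[OF tendsto_snd[OF lim]] tendsto_snd[OF tendsto_snd[OF lim]] l uk by auto
  have \<alpha>: "c \<le> \<alpha>" "\<alpha> \<le> 1" using LIMSEQ_le_const[OF la] LIMSEQ_le_const2[OF la] a by blast+
  then have "0 < \<alpha>" using assms by simp
  have X: "X \<in> psd_mats"
    by (rule closed_sequentially[OF closed_psd _ lX]) (simp add: pd_imp_psd pd_Xp pos)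
  have Z: "Z \<in> psd_mats"
    by (rule closed_sequentially[OF closed_psd _ lZ]) (simp add: pd_imp_psd pd_Zp pos)
  have "(\<lambda>k. Zp (a k) ** Xp (a k)) \<longlonglongrightarrow> Z ** X" by (rule matrix_mult_tendsto[OF lZ lX])
  moreover have "(\<lambda>k. Zp (a k) ** Xp (a k)) \<longlonglongrightarrow> \<alpha> *\<^sub>R mat 1"
    using Zp_Xp[OF pos] la by (simp add: tendsto_scaleR)
  ultimately have ZX: "Z ** X = \<alpha> *\<^sub>R mat 1" by (rule LIMSEQ_unique)
  have "det (Z ** X) \<noteq> 0" unfolding ZX by (rule pd_det_nz[OF pd_scale[OF pd_mat_1 \<open>0 < \<alpha>\<close>]])
  then have pd: "pos_def_mat X" "pos_def_mat Z" using psd_det_nz_imp_pd X Z by (auto simp: det_mul)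
  have lker: "(\<lambda>k. Xp (a k) - base (a k)) \<longlonglongrightarrow> X - base \<alpha>"
    unfolding base_def by (intro tendsto_intros lX la)
  have "X - base \<alpha> \<in> ker"
    by (rule closed_sequentially[OF closed_subspace[OF subspace_ker] _ lker])
      (use Xp_feas[OF pos] in \<open>simp add: feas_iff\<close>)
  then have "X \<in> feas \<alpha>" using X by (simp add: feas_iff)
  moreover have "Z \<in> range adj"
    by (rule closed_sequentially[OF range_adj_closed _ lZ]) (simp add: Zp_eq[OF pos])
  then obtain y where "Z = adj y" by blast
  ultimately have "path_system A b \<alpha> (X, y, Z)"
    using pd ZX by (simp add: path_system_iff pd_feas_iff del: path_system.simps)
  then have "X = Xp \<alpha>" "Z = Zp \<alpha>" using path_pointI[OF \<open>0 < \<alpha>\<close>] by blast+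
  then show "l \<in> (\<lambda>\<alpha>. (\<alpha>, Xp \<alpha>, Zp \<alpha>)) ` {c..1}" using l \<alpha> by simp
qed

text \<open>On each \<open>{c..1}\<close> the path has a closed graph and values in a compact set,
  hence is continuous there.\<close>

lemma continuous_on_path: "continuous_on {0<..1} (\<lambda>\<alpha>. (Xp \<alpha>, Zp \<alpha>))"
proof -
  obtain R where R: "\<And>\<alpha>. 0 < \<alpha> \<Longrightarrow> \<alpha> \<le> 1 \<Longrightarrow> norm (Xp \<alpha>) \<le> R" using Xp_bounded by blast
  obtain Q where Q: "\<And>\<alpha>. 0 < \<alpha> \<Longrightarrow> norm (Zp \<alpha>) \<le> Q" using Zp_bounded by blast
  have on: "continuous_on {c..1} (\<lambda>\<alpha>. (Xp \<alpha>, Zp \<alpha>))" if "0 < c" for c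
  proof (rule continuous_from_closed_graph)
    show "compact (cball (0 :: real^'n^'n) R \<times> cball (0 :: real^'n^'n) Q)" by (intro compact_Times compact_cball)
    show "(\<lambda>\<alpha>. (Xp \<alpha>, Zp \<alpha>)) \<in> {c..1} \<rightarrow> cball 0 R \<times> cball 0 Q"
      using R Q that by auto
    show "closed ((\<lambda>x. (x, Xp x, Zp x)) ` {c..1})" by (rule path_graph_closed[OF that])
  qed
  show ?thesis
    unfolding continuous_on_eq_continuous_within
  proof
    fix \<alpha> :: real assume \<alpha>: "\<alpha> \<in> {0<..1}"
    then have "continuous (at \<alpha> within {\<alpha> / 2..1}) (\<lambda>\<alpha>. (Xp \<alpha>, Zp \<alpha>))"
      using on[of "\<alpha> / 2"] by (simp add: continuous_on_eq_continuous_within)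
    \<comment> \<open>The two sets agree on the neighbourhood \<open>{\<alpha> / 2<..}\<close> of
      \<open>\<alpha>\<close>.\<close>
    moreover have "at \<alpha> within {\<alpha> / 2..1} = at \<alpha> within {0<..1}"
      using \<alpha> by (intro at_within_nhd[of _ "{\<alpha> / 2<..}"]) auto
    ultimately show "continuous (at \<alpha> within {0<..1}) (\<lambda>\<alpha>. (Xp \<alpha>, Zp \<alpha>))"
      by (simp add: continuous_within)
  qed
qed

section \<open>Existence of the limits, entry by entry\<close>

lemma Xp_limit: "\<exists>X. (Xp \<longlongrightarrow> X) (at_right 0)"
proof -
  obtain R where R: "\<And>\<alpha>. 0 < \<alpha> \<Longrightarrow> \<alpha> \<le> 1 \<Longrightarrow> norm (Xp \<alpha>) \<le> R" using Xp_bounded by blast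
  have "\<exists>l. ((\<lambda>\<alpha>. Xp \<alpha> $ i $ j) \<longlongrightarrow> l) (at_right 0)" for i j
  \<comment> \<open>Entries of \<open>X\<close> are polynomial in the coordinates, so the
    denominator is the constant \<open>1\<close>.\<close>
  proof (rule path_entry_limit[OF mat_of_entry_poly poly_deg_const, where G = "\<lambda>_. 1" and R = R])
    show "(\<lambda>k. mat_of (coords \<alpha> (Xk k \<alpha>)) $ i $ j) \<longlonglongrightarrow> Xp \<alpha> $ i $ j * 1" if "0 < \<alpha>" for \<alpha>
      using mat_of_coords[OF Xk(1)[OF that]] by (simp add: tendsto_vec_nth Xk_tendsto[OF that])
    show "continuous_on {0<..1} (\<lambda>\<alpha>. Xp \<alpha> $ i $ j)"
      using continuous_on_fst[OF continuous_on_path] by (auto intro!: continuous_intros)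
    show "\<bar>Xp \<alpha> $ i $ j\<bar> \<le> R" if "0 < \<alpha>" "\<alpha> \<le> 1" for \<alpha>
      using component_le_norm_cart[of "Xp \<alpha> $ i" j] Finite_Cartesian_Product.norm_nth_le[of "Xp \<alpha>" i] R[OF that]
      by linarith
  qed auto
  then obtain l where "\<And>i j. ((\<lambda>\<alpha>. Xp \<alpha> $ i $ j) \<longlongrightarrow> l i j) (at_right 0)" by metis
  then have "(Xp \<longlongrightarrow> (\<chi> i j. l i j)) (at_right 0)" by (intro vec_tendstoI) simp
  then show ?thesis by blast
qed

text \<open>Column \<open>j\<close> of \<open>Zp \<alpha>\<close> solves a linear system with matrix
  \<open>Xp \<alpha>\<close> and right-hand side \<alpha> times a basis vector. Cramer's rule writes
  each entry as a quotient of two polynomials of degree at most \<open>CARD('n)\<close> in the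
  coordinates, one of which is \<alpha>.\<close>

lemma Zp_limit: "\<exists>Z. (Zp \<longlongrightarrow> Z) (at_right 0)"
proof -
  obtain R where R: "\<And>\<alpha>. 0 < \<alpha> \<Longrightarrow> norm (Zp \<alpha>) \<le> R" using Zp_bounded by blast
  have "\<exists>l. ((\<lambda>\<alpha>. Zp \<alpha> $ i $ j) \<longlongrightarrow> l) (at_right 0)" for i j
  proof -
    let ?C = "\<lambda>\<alpha> X. (\<chi> p q. if q = i then (\<alpha> *\<^sub>R axis j 1 :: real^'n) $ p else X $ p $ q) :: real^'n^'n"
    have cramer': "det (?C \<alpha> (Xp \<alpha>)) = Zp \<alpha> $ i $ j * det (Xp \<alpha>)" if \<alpha>: "0 < \<alpha>" for \<alpha>
    proof -
      have nz: "det (Xp \<alpha>) \<noteq> 0" by (rule pd_det_nz[OF pd_Xp[OF \<alpha>]])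
      have "Xp \<alpha> ** Zp \<alpha> = \<alpha> *\<^sub>R mat 1" using inverse_pair_commute[OF Zp_Xp[OF \<alpha>]] \<alpha> by simp
      then have "Xp \<alpha> *v (Zp \<alpha> *v axis j 1) = \<alpha> *\<^sub>R axis j 1"
        by (simp add: matrix_vector_mul_assoc flip: scaleR_matrix_vector_assoc)
      then have "Zp \<alpha> *v axis j 1 = (\<chi> k. det (\<chi> p q. if q = k then (\<alpha> *\<^sub>R axis j 1) $ p else Xp \<alpha> $ p $ q) / det (Xp \<alpha>))"
        using cramer[OF nz] by blast
      then have "(Zp \<alpha> *v axis j 1) $ i = det (?C \<alpha> (Xp \<alpha>)) / det (Xp \<alpha>)" by simp
      moreover have "(Zp \<alpha> *v axis j 1) $ i = Zp \<alpha> $ i $ j" by (simp add: matrix_vector_mult_basis column_def)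
      ultimately show ?thesis using nz by simp
    qed
    have poly: "poly_deg (insert None vars) CARD('n) (\<lambda>x. det (?C (x None) (mat_of x)))"
    proof (rule poly_deg_det)
      fix p q
      have "poly_deg (insert None vars) (1 + 0) (\<lambda>x. x None * (axis j 1 :: real^'n) $ p)"
        using finite_vars by (intro poly_deg_mult poly_deg_var poly_deg_const) auto
      then show "poly_deg (insert None vars) 1 (\<lambda>x. ?C (x None) (mat_of x) $ p $ q)"
        using mat_of_entry_poly by (cases "q = i") simp_all
    qed
    show ?thesis
    proof (rule path_entry_limit[OF poly dets_poly, where G = "\<lambda>\<alpha>. det (Xp \<alpha>)" and R = R])
      fix \<alpha> :: real assume \<alpha>: "0 < \<alpha>"
      have "(\<lambda>k. ?C \<alpha> (Xk k \<alpha>)) \<longlonglongrightarrow> ?C \<alpha> (Xp \<alpha>)"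
        by (intro vec_tendstoI) (auto intro!: tendsto_vec_nth Xk_tendsto[OF \<alpha>])
      then have "(\<lambda>k. det (?C \<alpha> (Xk k \<alpha>))) \<longlonglongrightarrow> det (?C \<alpha> (Xp \<alpha>))"
        by (intro continuous_on_tendsto_compose[OF continuous_on_det[of UNIV]]) auto
      then show "(\<lambda>k. det (?C (coords \<alpha> (Xk k \<alpha>) None) (mat_of (coords \<alpha> (Xk k \<alpha>))))) \<longlonglongrightarrow> Zp \<alpha> $ i $ j * det (Xp \<alpha>)"
        unfolding cramer'[OF \<alpha>] coords_simps mat_of_coords[OF Xk(1)[OF \<alpha>]] .
      show "(\<lambda>k. dets (coords \<alpha> (Xk k \<alpha>))) \<longlonglongrightarrow> det (Xp \<alpha>)"
        unfolding dets_def mat_of_coords[OF Xk(1)[OF \<alpha>]] by (rule det_Xk_tendsto[OF \<alpha>])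
      show "det (Xp \<alpha>) \<noteq> 0" by (rule pd_det_nz[OF pd_Xp[OF \<alpha>]])
      show "\<bar>Zp \<alpha> $ i $ j\<bar> \<le> R"
        using component_le_norm_cart[of "Zp \<alpha> $ i" j] Finite_Cartesian_Product.norm_nth_le[of "Zp \<alpha>" i] R[OF \<alpha>]
        by linarith
    next
      show "continuous_on {0<..1} (\<lambda>\<alpha>. Zp \<alpha> $ i $ j)"
        using continuous_on_snd[OF continuous_on_path] by (auto intro!: continuous_intros)
    qed
  qed
  then obtain l where "\<And>i j. ((\<lambda>\<alpha>. Zp \<alpha> $ i $ j) \<longlongrightarrow> l i j) (at_right 0)" by metis
  then have "(Zp \<longlongrightarrow> (\<chi> i j. l i j)) (at_right 0)" by (intro vec_tendstoI) simp
  then show ?thesis by blast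
qed

section \<open>Position of the limit point\<close>

lemma eventually_pos: "\<forall>\<^sub>F \<alpha> in at_right 0. 0 < (\<alpha>::real)"
  by (simp add: eventually_at_right_less)

lemma convex_spectrahedron: "convex (spectrahedron A b)"
proof -
  have "spectrahedron A b = psd_mats \<inter> symA -` {b}"
    using symA_eq psd_sym by (auto simp: spectrahedron_def)
  moreover have "convex (symA -` {b})" by (rule convex_linear_vimage[OF linear_symA convex_singleton])
  ultimately show ?thesis using convex_Int[OF convex_psd] by metis
qed

lemma limit_spectrahedron:
  assumes lim: "(Xp \<longlongrightarrow> X) (at_right 0)"
  shows "X \<in> spectrahedron A b"
proof -
  have X: "X \<in> psd_mats"
    by (rule Lim_in_closed_set[OF closed_psd _ trivial_limit_at_right_real lim])
      (auto intro: eventually_mono[OF eventually_pos] pd_imp_psd pd_Xp)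
  have *: "((\<lambda>\<alpha>. Xp \<alpha> - base \<alpha>) \<longlongrightarrow> X - base 0) (at_right 0)"
    unfolding base_def by (intro tendsto_intros lim)
  have "X - base 0 \<in> ker"
    by (rule Lim_in_closed_set[OF closed_subspace[OF subspace_ker] _ trivial_limit_at_right_real *])
      (rule eventually_mono[OF eventually_pos], use Xp_feas feas_iff in blast)
  then have "X \<in> feas 0" using X by (simp add: feas_iff)
  then show ?thesis by (simp add: feas_def spectrahedron_def perturbed_rhs_def)
qed

text \<open>By convexity it suffices that every segment from a point \<open>W\<close> of the
  spectrahedron to \<open>X\<close> extends beyond \<open>X\<close>. The Loewner bound of
  \<open>W\<close> by a multiple of \<open>X\<close>, obtained from
  \<open>spectrahedron_le_Xp\<close>, leaves room for this.\<close>

lemma limit_rel_interior: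
  assumes lim: "(Xp \<longlongrightarrow> X) (at_right 0)"
  shows "X \<in> rel_interior (spectrahedron A b)"
proof -
  have X: "X \<in> psd_mats" "A X = b" using limit_spectrahedron[OF lim] by (auto simp: spectrahedron_def)
  define c where "c = real CARD('n)"
  have "c > 0" by (simp add: c_def)
  have "\<exists>e>1. (1 - e) *\<^sub>R W + e *\<^sub>R X \<in> spectrahedron A b" if W: "W \<in> spectrahedron A b" for W
  \<comment> \<open>With this factor the extended point is
    \<open>(1 / c) *\<^sub>R (c *\<^sub>R X - W) + (1 / c) *\<^sub>R X\<close>, a sum of two
    positive semidefinite matrices.\<close>
  proof (intro exI[of _ "1 + 1 / c"] conjI)
    show "1 < 1 + 1 / c" using \<open>c > 0\<close> by simp
    let ?Y = "(1 - (1 + 1 / c)) *\<^sub>R W + (1 + 1 / c) *\<^sub>R X"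
    have W': "W \<in> psd_mats" "A W = b" using W by (auto simp: spectrahedron_def)
    have le: "v \<bullet> (W *v v) \<le> c * (v \<bullet> (X *v v))" for v
    proof (rule tendsto_lowerbound)
      have "((\<lambda>\<alpha>. v \<bullet> (Xp \<alpha> *v v)) \<longlongrightarrow> v \<bullet> (X *v v)) (at_right 0)"
        by (rule continuous_on_tendsto_compose[OF continuous_quadratic_form lim]) auto
      then show "((\<lambda>\<alpha>. c * (v \<bullet> (Xp \<alpha> *v v))) \<longlongrightarrow> c * (v \<bullet> (X *v v))) (at_right 0)"
        by (rule tendsto_mult_left)
      show "\<forall>\<^sub>F \<alpha> in at_right 0. v \<bullet> (W *v v) \<le> c * (v \<bullet> (Xp \<alpha> *v v))"
        unfolding c_def by (rule eventually_mono[OF eventually_pos spectrahedron_le_Xp[OF _ W]])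
    qed simp
    have sym: "?Y \<in> sym_mats"
      using psd_sym[OF X(1)] psd_sym[OF W'(1)] subspace_sym_mats by (intro subspace_add subspace_scale)
    have "0 \<le> v \<bullet> (?Y *v v)" for v
    proof -
      have "v \<bullet> (?Y *v v) = (1 / c) * (c * (v \<bullet> (X *v v)) - v \<bullet> (W *v v)) + (1 / c) * (v \<bullet> (X *v v))"
        unfolding matrix_vector_mult_add_rdistrib scaleR_matrix_vector_assoc[symmetric] inner_add_right
          inner_scaleR_right
        using \<open>c > 0\<close> by (simp add: field_simps)
      also have "\<dots> \<ge> 0"
        using le[of v] psd_nonneg[OF X(1), of v] \<open>c > 0\<close> by (intro add_nonneg_nonneg mult_nonneg_nonneg) auto
      finally show ?thesis .
    qed
    then have "?Y \<in> psd_mats" using sym by (simp add: psd_mats_def)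
    moreover have "A ?Y = b"
    proof -
      have "A ?Y = (1 - (1 + 1 / c)) *\<^sub>R symA W + (1 + 1 / c) *\<^sub>R symA X"
        using symA_eq[OF sym] by (simp only: linear_add[OF linear_symA] linear_cmul[OF linear_symA])
      also have "\<dots> = b"
        using W' X symA_eq[OF psd_sym[OF X(1)]] symA_eq[OF psd_sym[OF W'(1)]]
        by (simp add: scaleR_left_distrib)
      finally show ?thesis .
    qed
    ultimately show "?Y \<in> spectrahedron A b" by (simp add: spectrahedron_def)
  qed
  then show ?thesis
    using convex_rel_interior_iff[OF convex_spectrahedron] X0 by blast
qed

lemma path_converges:
  "\<exists>Xb yb Zb. Xb \<in> psd_mats \<and> Zb \<in> psd_mats \<and> Xb \<in> rel_interior (spectrahedron A b) \<and>
     Zb = sym_adjoint A yb \<and> (path_point A b \<longlongrightarrow> (Xb, yb, Zb)) (at_right 0)"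
proof -
  obtain X Z where X: "(Xp \<longlongrightarrow> X) (at_right 0)" and Z: "(Zp \<longlongrightarrow> Z) (at_right 0)"
    using Xp_limit Zp_limit by blast
  \<comment> \<open>A linear left inverse of \<open>adj\<close> recovers \<open>yp\<close> from
    \<open>Zp\<close>, so convergence of \<open>yp\<close> follows from that of
    \<open>Zp\<close>.\<close>
  obtain L where L: "linear L" "\<And>y. L (adj y) = y"
    using linear_injective_left_inverse[OF linear_adj inj_adj] by (metis comp_apply id_apply)
  have "((\<lambda>\<alpha>. L (Zp \<alpha>)) \<longlongrightarrow> L Z) (at_right 0)"
    by (rule linear_continuous_at[THEN isContD, THEN tendsto_compose, OF _ Z])
      (simp add: L linear_conv_bounded_linear[symmetric])
  moreover have "\<forall>\<^sub>F \<alpha> in at_right 0. L (Zp \<alpha>) = yp \<alpha>"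
    by (rule eventually_mono[OF eventually_pos]) (simp add: Zp_eq L)
  ultimately have y: "(yp \<longlongrightarrow> L Z) (at_right 0)" by (rule Lim_transform_eventually)
  have "Z \<in> range adj"
    by (rule Lim_in_closed_set[OF range_adj_closed _ trivial_limit_at_right_real Z])
      (rule eventually_mono[OF eventually_pos], simp add: Zp_eq)
  then have "Z = sym_adjoint A (L Z)" using L(2) by (auto simp: sym_adjoint_eq)
  moreover have "Z \<in> psd_mats"
    by (rule Lim_in_closed_set[OF closed_psd _ trivial_limit_at_right_real Z])
      (auto intro: eventually_mono[OF eventually_pos] pd_imp_psd pd_Zp)
  moreover have "(path_point A b \<longlongrightarrow> (X, L Z, Z)) (at_right 0)"
    using tendsto_Pair[OF X tendsto_Pair[OF y Z]] by (simp add: path_point_eq[abs_def])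
  moreover have "X \<in> psd_mats" using limit_spectrahedron[OF X] by (simp add: spectrahedron_def)
  ultimately show ?thesis using limit_rel_interior[OF X] by blast
qed

end

theorem theorem3p12:
  fixes A :: "real^'n^'n \<Rightarrow> real^'m" and b :: "real^'m"
  assumes "linear_on_sym A"
    and "A ` sym_mats = UNIV"
    and "spectrahedron A b \<noteq> {}"
    and "bounded (spectrahedron A b)"
    and "\<exists>f. proper_psd_face f \<and> spectrahedron A b \<subseteq> f"
  shows "\<exists>Xb yb Zb. Xb \<in> psd_mats \<and> Zb \<in> psd_mats \<and>
           Xb \<in> rel_interior (spectrahedron A b) \<and>
           Zb = sym_adjoint A yb \<and>
           (path_point A b \<longlongrightarrow> (Xb, yb, Zb)) (at_right 0)"
proof -
  obtain X0 where "X0 \<in> spectrahedron A b" using assms(3) by blast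
  then interpret bounded_spectrahedron A b X0
    using assms by unfold_locales
  show ?thesis by (rule path_converges)
qed

end
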